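(* Let $S\subset\mathbb{R}^n$ be a relatively open piece of a $C^1$ hypersurface and let $f\in C_c(\mathbb{R}^n)$ satisfy $R_Sf=0$. If there is a point $p_0\in S$ such that $\operatorname{supp} f$ lies strictly on one side of the tangent hyperplane $T_{p_0}S$ (i.e. $\operatorname{supp} f$ is contained in one of the open half-spaces bounded by $T_{p_0}S$), then $f\equiv 0$.
   Context: $C_c(\mathbb{R}^n)$ is the space of compactly supported continuous functions. For a continuous function $f$, $Rf(p,r)=\int_{|y-p|=r}f(y)\,d\sigma(y)$ with $d\sigma$ the surface measure on the sphere of radius $r>0$ centered at $p$. "$R_Sf=0$" means $Rf(p,r)=0$ for all $p\in S$ and all $r>0$. *)

theory Defs
  imports "HOL-Analysis.Analysis"
begin

text \<open>Surface measure on the unit sphere of a Euclidean space, defined as the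
  cone measure: sigma(A) = n * lambda({t w | 0 < t <= 1, w in A}), i.e. n times the
  push-forward of Lebesgue measure on the unit ball under x |-> x/|x|.\<close>
definition unit_sphere_measure :: "'a::euclidean_space measure" where
  "unit_sphere_measure =
     scale_measure (of_nat DIM('a)) (distr (restrict_space lborel (ball 0 1)) borel sgn)"

text \<open>Spherical integral  Rf(p,r) = integral of f over the sphere |y - p| = r w.r.t.
  surface measure, i.e. r^(n-1) times the integral of f(p + r w) over the unit sphere.\<close>
definition sph_mean :: "('a::euclidean_space \<Rightarrow> real) \<Rightarrow> 'a \<Rightarrow> real \<Rightarrow> real" where
  "sph_mean f p r = r ^ (DIM('a) - 1) * (\<integral>w. f (p + r *\<^sub>R w) \<partial>unit_sphere_measure)"

definition local_defining_fn ::
  "'a::euclidean_space set \<Rightarrow> 'a \<Rightarrow> 'a set \<Rightarrow> ('a \<Rightarrow> real) \<Rightarrow> ('a \<Rightarrow> 'a) \<Rightarrow> bool" where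
  "local_defining_fn M p U g G \<longleftrightarrow>
     open U \<and> p \<in> U \<and>
     (\<forall>x\<in>U. (g has_derivative (\<lambda>v. G x \<bullet> v)) (at x)) \<and>
     continuous_on U G \<and> (\<forall>x\<in>U. G x \<noteq> 0) \<and>
     M \<inter> U = {x\<in>U. g x = 0}"

definition C1_hypersurface :: "'a::euclidean_space set \<Rightarrow> bool" where
  "C1_hypersurface M \<longleftrightarrow> (\<forall>p\<in>M. \<exists>U g G. local_defining_fn M p U g G)"

end

theory Submission
  imports Defs
begin

text \<open>
  Vanishing spherical integrals at \<open>p\<close> give \<open>V p l = 0\<close> for all \<open>l\<close>, where \<open>V p l\<close> is the integral of
  \<open>exp (- l * (norm (x - p))\<^sup>2) * f x\<close>; up to a power of \<open>t = 1 / (4 * l)\<close>, \<open>V\<close> solves the heat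
  equation. Let \<open>r\<close> be the distance from \<open>p0\<close> to the support of \<open>f\<close>, and consider the part of a small
  ball around \<open>p0\<close> that lies behind \<open>S\<close>. There \<open>V\<close> vanishes on \<open>S\<close>, and on the rest of the boundary it
  is of order \<open>exp (- l * d\<^sup>2)\<close>, where \<open>d\<close> is the distance to the support. Because the support lies
  strictly on one side of the tangent plane, \<open>d\<close> falls below \<open>r\<close> by less than the radius of the ball.
  Comparison with a barrier whose exponent has slope less than one (the heat equation's version of
  finite propagation speed) then yields decay of order \<open>exp (- l * a)\<close> with \<open>a > r\<^sup>2\<close> for all
  centres in an open set close to \<open>p0\<close>, and this forces \<open>f\<close> to vanish near its support point
  nearest to \<open>p0\<close>.
\<close>

subsection \<open>From spherical integrals to radial integrals\<close>

lemma integral_unit_sphere_measure: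
  fixes h :: "'a::euclidean_space \<Rightarrow> real"
  assumes [measurable]: "h \<in> borel_measurable borel"
  shows "(\<integral>w. h w \<partial>unit_sphere_measure) = DIM('a) * (LINT x:ball 0 1|lborel. h (sgn x))"
proof -
  have msgn [measurable]: "(sgn :: 'a \<Rightarrow> 'a) \<in> borel_measurable borel"
    unfolding sgn_div_norm by measurable
  \<comment> \<open>As a constant density, the factor \<open>DIM('a)\<close> can be pulled through
    Bochner integrals.\<close>
  have eq: "(unit_sphere_measure :: 'a measure)
      = density (distr (restrict_space lborel (ball 0 1)) borel sgn) (\<lambda>_. ennreal DIM('a))"
    unfolding unit_sphere_measure_def
    by (intro measure_eqI)
      (simp_all add: emeasure_density_const ennreal_of_nat_eq_real_of_nat)
  have "(\<integral>w. h w \<partial>unit_sphere_measure)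
      = (\<integral>x. DIM('a) *\<^sub>R h x \<partial>distr (restrict_space lborel (ball 0 1)) borel sgn)"
    unfolding eq by (subst integral_density) auto
  also have "\<dots> = (\<integral>x. DIM('a) *\<^sub>R h (sgn x) \<partial>restrict_space lborel (ball 0 1))"
    by (subst integral_distr) (auto intro!: measurable_restrict_space1)
  also have "\<dots> = DIM('a) * (LINT x:ball 0 1|lborel. h (sgn x))"
    by (subst integral_restrict_space) (simp_all add: set_lebesgue_integral_def mult.left_commute)
  finally show ?thesis .
qed

text \<open>The integrand is homogeneous of degree 0, so scaling by \<open>\<rho>\<close>
  contributes only its Jacobian.\<close>

lemma set_integral_ball_sgn_scale:
  fixes h :: "'a::euclidean_space \<Rightarrow> real"
  assumes [measurable]: "h \<in> borel_measurable borel" and "\<rho> > 0"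
  shows "(LINT x:ball 0 \<rho>|lborel. h (sgn x)) = \<rho> ^ DIM('a) * (LINT x:ball 0 1|lborel. h (sgn x))"
proof -
  have msgn [measurable]: "(sgn :: 'a \<Rightarrow> 'a) \<in> borel_measurable borel"
    unfolding sgn_div_norm by measurable
  have [measurable]: "(\<lambda>x::'a. indicator (ball 0 \<rho>) x * h (sgn x)) \<in> borel_measurable borel"
    by (intro borel_measurable_times borel_measurable_indicator measurable_compose[OF msgn assms(1)]) auto
  have *: "indicator (ball 0 \<rho>) (\<rho> *\<^sub>R x) = (indicator (ball 0 1) x :: real)" for x :: 'a
    using \<open>\<rho> > 0\<close> by (auto simp: indicator_def)
  have "(lborel :: 'a measure)
      = density (distr lborel borel (\<lambda>x. 0 + \<rho> *\<^sub>R x)) (\<lambda>_. ennreal (\<bar>\<rho>\<bar> ^ DIM('a)))"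
    using \<open>\<rho> > 0\<close> by (intro lborel_affine) auto
  then have "(LINT x:ball 0 \<rho>|lborel. h (sgn x))
    = (LINT x:ball 0 \<rho>|density (distr lborel borel (\<lambda>x::'a. 0 + \<rho> *\<^sub>R x)) (\<lambda>_. ennreal (\<bar>\<rho>\<bar> ^ DIM('a))). h (sgn x))"
    by simp
  also have "\<dots> = (LINT x|distr lborel borel (\<lambda>x::'a. 0 + \<rho> *\<^sub>R x). \<rho> ^ DIM('a) * (indicator (ball 0 \<rho>) x * h (sgn x)))"
    using \<open>\<rho> > 0\<close> unfolding set_lebesgue_integral_def by (subst integral_density) auto
  also have "\<dots> = (LINT x|lborel. \<rho> ^ DIM('a) * (indicator (ball 0 1) x * h (sgn (x::'a))))"
    using \<open>\<rho> > 0\<close> by (subst integral_distr) (auto simp: * sgn_scaleR)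
  finally show ?thesis by (simp add: set_lebesgue_integral_def)
qed

lemma set_integrable_lborel_bounded:
  fixes F :: "'a::euclidean_space \<Rightarrow> real"
  assumes [measurable]: "F \<in> borel_measurable borel" "A \<in> sets borel"
    and "bounded A" and F: "\<And>x. x \<in> A \<Longrightarrow> \<bar>F x\<bar> \<le> K"
  shows "set_integrable lborel A F"
  unfolding set_integrable_def
proof (rule Bochner_Integration.integrable_bound[where f = "\<lambda>x. indicator A x *\<^sub>R K"])
  have "emeasure lborel A < \<infinity>"
    using \<open>bounded A\<close> by (rule emeasure_bounded_finite)
  then show "integrable lborel (\<lambda>x. indicator A x *\<^sub>R K)"
    by (intro integrable_scaleR_left integrable_real_indicator) auto
  show "AE x in lborel. norm (indicator A x *\<^sub>R F x) \<le> norm (indicator A x *\<^sub>R K)"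
  proof (rule AE_I2)
    show "norm (indicator A x *\<^sub>R F x) \<le> norm (indicator A x *\<^sub>R K)" for x
      using F[of x] by (cases "x \<in> A") auto
  qed
qed measurable

text \<open>This replaces integration in polar coordinates. Rounding the radius to multiples of
  \<open>1 / (N + 1)\<close> turns \<open>H\<close> into \<open>h N\<close>, which on each shell
  depends on \<open>sgn x\<close> alone. Such a function integrates to 0 over both balls bounding
  the shell, hence over the shell; dominated convergence passes from \<open>h N\<close> to
  \<open>H\<close>.\<close>

lemma integral_ball_eq_0_if_sphere_integrals_eq_0:
  fixes H :: "'a::euclidean_space \<Rightarrow> real"
  assumes cont: "continuous_on UNIV H"
    and zero: "\<And>r. r > 0 \<Longrightarrow> (\<integral>w. H (r *\<^sub>R w) \<partial>unit_sphere_measure) = 0"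
  shows "(LINT x:ball 0 (real m)|lborel. H x) = 0"
proof -
  have msgn [measurable]: "(sgn :: 'a \<Rightarrow> 'a) \<in> borel_measurable borel"
    unfolding sgn_div_norm by measurable
  have mH [measurable]: "H \<in> borel_measurable borel"
    using cont by (rule borel_measurable_continuous_onI)
  have ball0: "(LINT x:ball 0 \<rho>|lborel. H (r *\<^sub>R sgn x)) = 0" if "r > 0" for r \<rho>
  proof (cases "\<rho> > 0")
    case True
    have "(LINT x:ball 0 1|lborel. H (r *\<^sub>R sgn x)) = 0"
      using zero[OF that] integral_unit_sphere_measure[of "\<lambda>w. H (r *\<^sub>R w)"] by simp
    then show ?thesis
      using set_integral_ball_sgn_scale[of "\<lambda>w. H (r *\<^sub>R w)" \<rho>] True by simp
  next
    case False
    then show ?thesis by (simp add: ball_empty set_lebesgue_integral_def)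
  qed
  define r where "r N x = (real_of_int \<lfloor>real (Suc N) * norm x\<rfloor> + 1) / real (Suc N)" for N and x :: 'a
  define h where "h N x = H (r N x *\<^sub>R sgn x)" for N x
  have mh [measurable]: "h N \<in> borel_measurable borel" for N
    unfolding h_def r_def by measurable
  \<comment> \<open>Rounding can raise the radius by up to 1, hence the bound on the ball of radius
    \<open>m + 1\<close>.\<close>
  have "compact (H ` cball 0 (real m + 1))"
    by (rule compact_continuous_image) (auto intro: continuous_on_subset[OF cont])
  then obtain K where "\<forall>y\<in>H ` cball 0 (real m + 1). norm y \<le> K"
    using compact_imp_bounded bounded_iff by metis
  then have K: "\<bar>H x\<bar> \<le> K" if "norm x \<le> real m + 1" for x
    using that by auto
  have r_bounds: "norm x < r N x" "r N x \<le> norm x + 1 / real (Suc N)" for N x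
  proof -
    have "real (Suc N) * norm x < real_of_int \<lfloor>real (Suc N) * norm x\<rfloor> + 1"
      "real_of_int \<lfloor>real (Suc N) * norm x\<rfloor> + 1 \<le> real (Suc N) * norm x + 1"
      by linarith+
    then show "norm x < r N x" "r N x \<le> norm x + 1 / real (Suc N)"
      unfolding r_def by (simp_all add: field_simps del: of_nat_Suc)
  qed
  have hK: "\<bar>h N x\<bar> \<le> K" if "norm x < m" for N x
  proof -
    have "1 / real (Suc N) \<le> 1" by simp
    then have "r N x \<le> real m + 1" using r_bounds(2)[where N=N and x=x] that by linarith
    moreover have "0 < r N x" using r_bounds(1)[where N=N and x=x] norm_ge_zero[of x] by linarith
    ultimately have "norm (r N x *\<^sub>R sgn x) \<le> real m + 1"
      by (cases "x = 0") (auto simp: norm_sgn)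
    then show ?thesis unfolding h_def by (rule K)
  qed
  have int_h: "set_integrable lborel A (h N)" if "A \<subseteq> ball 0 (real m)" "A \<in> sets borel" for N A
    by (rule set_integrable_lborel_bounded[where K = K])
      (use that hK in \<open>auto intro: bounded_subset[OF bounded_ball]\<close>)
  have shell: "(LINT x:ball 0 (real k / real (Suc N))|lborel. h N x) = 0"
    if "real k \<le> real m * real (Suc N)" for k N
    using that
  proof (induction k)
    case 0
    then show ?case by (simp add: set_lebesgue_integral_def)
  next
    case (Suc k)
    let ?a = "real k / real (Suc N)" and ?b = "real (Suc k) / real (Suc N)"
    have ab: "?a \<le> ?b" by (simp add: divide_right_mono)
    have bm: "?b \<le> real m" using Suc.prems by (simp add: field_simps del: of_nat_Suc)
    have split: "ball 0 ?b = ball (0::'a) ?a \<union> (ball 0 ?b - ball 0 ?a)"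
      using ab by auto
    have un: "(LINT x:ball 0 ?b|lborel. F x)
        = (LINT x:ball 0 ?a|lborel. F x) + (LINT x:ball 0 ?b - ball 0 ?a|lborel. F x)"
      if "\<And>A. A \<subseteq> ball 0 (real m) \<Longrightarrow> A \<in> sets borel \<Longrightarrow> set_integrable lborel A F"
      for F :: "'a \<Rightarrow> real"
      by (subst split, rule set_integral_Un) (use ab bm in \<open>auto intro!: that\<close>)
    have "(LINT x:ball 0 ?b - ball 0 ?a|lborel. h N x)
        = (LINT x:ball 0 ?b - ball 0 ?a|lborel. H (?b *\<^sub>R sgn x))"
    proof (rule set_lebesgue_integral_cong; (intro allI impI)?)
      fix x :: 'a assume "x \<in> ball 0 ?b - ball 0 ?a"
      then have "real k \<le> real (Suc N) * norm x" "real (Suc N) * norm x < real k + 1"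
        by (auto simp: field_simps)
      then have "\<lfloor>real (Suc N) * norm x\<rfloor> = int k"
        by (intro floor_unique) auto
      then show "h N x = H (?b *\<^sub>R sgn x)" by (simp add: h_def r_def add.commute)
    qed auto
    also have "\<dots> = 0"
    proof -
      have "?b > 0" by simp
      have bnd: "\<bar>H (?b *\<^sub>R sgn x)\<bar> \<le> K" for x
        by (rule K) (use bm in \<open>auto simp: norm_sgn\<close>)
      have "set_integrable lborel A (\<lambda>x. H (?b *\<^sub>R sgn x))"
        if "A \<subseteq> ball 0 (real m)" "A \<in> sets borel" for A
        by (rule set_integrable_lborel_bounded[where K = K])
          (use that bnd in \<open>auto intro: bounded_subset[OF bounded_ball]\<close>)
      from un[OF this] ball0[OF \<open>?b > 0\<close>, of ?a] ball0[OF \<open>?b > 0\<close>, of ?b]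
      show ?thesis by linarith
    qed
    finally have "(LINT x:ball 0 ?b - ball 0 ?a|lborel. h N x) = 0" .
    moreover have "(LINT x:ball 0 ?a|lborel. h N x) = 0"
      using Suc.prems by (intro Suc.IH) simp
    ultimately show ?case using un[OF int_h, of N] by linarith
  qed
  have zero_h: "(LINT x:ball 0 (real m)|lborel. h N x) = 0" for N
  proof -
    have "real (m * Suc N) / real (Suc N) = real m"
      unfolding of_nat_mult by (rule nonzero_mult_div_cancel_right) simp
    then show ?thesis using shell[of "m * Suc N" N] by (simp only: of_nat_mult)
  qed
  have lim: "(\<lambda>N. h N x) \<longlonglongrightarrow> H x" for x
  proof -
    have "(\<lambda>N. r N x) \<longlonglongrightarrow> norm x"
    proof (rule tendsto_sandwich)
      show "\<forall>\<^sub>F N in sequentially. norm x \<le> r N x"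
        by (intro always_eventually allI less_imp_le r_bounds(1))
      show "\<forall>\<^sub>F N in sequentially. r N x \<le> norm x + 1 / real (Suc N)"
        by (intro always_eventually allI r_bounds(2))
      show "(\<lambda>N. norm x + 1 / real (Suc N)) \<longlonglongrightarrow> norm x"
        using tendsto_add[OF tendsto_const lim_1_over_n[THEN LIMSEQ_Suc]] by simp
    qed (rule tendsto_const)
    then have "(\<lambda>N. r N x *\<^sub>R sgn x) \<longlonglongrightarrow> norm x *\<^sub>R sgn x" by (intro tendsto_intros)
    moreover have "norm x *\<^sub>R sgn x = x" by (cases "x = 0") (simp_all add: sgn_div_norm)
    ultimately have "(\<lambda>N. r N x *\<^sub>R sgn x) \<longlonglongrightarrow> x" by simp
    then show ?thesis unfolding h_def
      by (rule continuous_on_tendsto_compose[OF cont]) auto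
  qed
  have "(\<lambda>N. LINT x:ball 0 (real m)|lborel. h N x) \<longlonglongrightarrow> (LINT x:ball 0 (real m)|lborel. H x)"
    unfolding set_lebesgue_integral_def
  proof (rule integral_dominated_convergence[where w="\<lambda>x. indicator (ball 0 (real m)) x *\<^sub>R K"])
    show "integrable lborel (\<lambda>x::'a. indicator (ball 0 (real m)) x *\<^sub>R K)"
      using set_integrable_lborel_bounded[of "\<lambda>_. K" "ball (0::'a) (real m)" "\<bar>K\<bar>"]
      by (simp add: set_integrable_def)
    show "AE x in lborel. (\<lambda>N. indicator (ball 0 (real m)) x *\<^sub>R h N x)
        \<longlonglongrightarrow> indicator (ball 0 (real m)) x *\<^sub>R H x"
      by (intro AE_I2 tendsto_intros lim)
    show "AE x in lborel. norm (indicator (ball 0 (real m)) x *\<^sub>R h N x)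
        \<le> indicator (ball 0 (real m)) x *\<^sub>R K" for N
      using hK by (intro AE_I2) (auto simp: indicator_def)
  qed (auto intro!: borel_measurable_times borel_measurable_indicator mH mh)
  then show ?thesis using zero_h by (simp add: LIMSEQ_const_iff)
qed

subsection \<open>Recovering a function from the decay of its Gaussian transform\<close>

text \<open>The pointwise limit, for growing \<open>l\<close>, of
  \<open>1 - exp (- exp (l * (c - s)))\<close>, a power series in \<open>exp (- l * s)\<close> with
  no constant term; this explains the value at \<open>s = c\<close>.\<close>

definition soft_cutoff :: "real \<Rightarrow> real \<Rightarrow> real" where
  "soft_cutoff c s = (if s < c then 1 else if s = c then 1 - exp (- 1) else 0)"

lemma tendsto_soft_cutoff:
  "(\<lambda>j. 1 - exp (- exp (real j * (c - s)))) \<longlonglongrightarrow> soft_cutoff c s"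
proof -
  consider "s < c" | "s = c" | "s > c" by linarith
  then show ?thesis
  proof cases
    case 1
    then have "filterlim (\<lambda>j. real j * (c - s)) at_top sequentially"
      by (intro filterlim_at_top_mult_tendsto_pos[OF tendsto_const] filterlim_real_sequentially) auto
    then have "filterlim (\<lambda>j. - exp (real j * (c - s))) at_bot sequentially"
      by (intro filterlim_compose[OF filterlim_uminus_at_bot_at_top] filterlim_compose[OF exp_at_top])
    then have "(\<lambda>j. 1 - exp (- exp (real j * (c - s)))) \<longlonglongrightarrow> 1 - 0"
      by (intro tendsto_intros filterlim_compose[OF exp_at_bot])
    with 1 show ?thesis by (simp add: soft_cutoff_def)
  next
    case 2
    then show ?thesis by (simp add: soft_cutoff_def)
  next
    case 3
    then have "filterlim (\<lambda>j. real j * (s - c)) at_top sequentially"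
      by (intro filterlim_at_top_mult_tendsto_pos[OF tendsto_const] filterlim_real_sequentially) auto
    then have "filterlim (\<lambda>j. - (real j * (s - c))) at_bot sequentially"
      by (intro filterlim_compose[OF filterlim_uminus_at_bot_at_top])
    then have "(\<lambda>j. exp (- (real j * (s - c)))) \<longlonglongrightarrow> 0"
      by (intro filterlim_compose[OF exp_at_bot])
    then have "(\<lambda>j. exp (real j * (c - s))) \<longlonglongrightarrow> 0"
      by (simp add: algebra_simps)
    then have "(\<lambda>j. 1 - exp (- exp (real j * (c - s)))) \<longlonglongrightarrow> 1 - exp (- 0)"
      by (intro tendsto_intros)
    with 3 show ?thesis by (simp add: soft_cutoff_def)
  qed
qed

lemma integral_soft_cutoff:
  fixes s F :: "'a::euclidean_space \<Rightarrow> real"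
  assumes s: "continuous_on (cbox u v) s" and F: "continuous_on (cbox u v) F"
  shows "(\<lambda>x. soft_cutoff c (s x) * F x) integrable_on cbox u v"
    and "(\<lambda>j. integral (cbox u v) (\<lambda>x. (1 - exp (- exp (real j * (c - s x)))) * F x))
      \<longlonglongrightarrow> integral (cbox u v) (\<lambda>x. soft_cutoff c (s x) * F x)"
proof -
  have 1: "(\<lambda>x. (1 - exp (- exp (real j * (c - s x)))) * F x) integrable_on cbox u v" for j
    by (intro integrable_continuous continuous_intros assms)
  have 2: "(\<lambda>x. \<bar>F x\<bar>) integrable_on cbox u v"
    by (intro integrable_continuous continuous_intros assms)
  have 3: "norm ((1 - exp (- exp (real j * (c - s x)))) * F x) \<le> \<bar>F x\<bar>" for j x
  proof -
    have "\<bar>1 - exp (- exp (real j * (c - s x)))\<bar> \<le> 1" by auto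
    then show ?thesis by (simp add: abs_mult mult_left_le_one_le)
  qed
  have 4: "(\<lambda>j. (1 - exp (- exp (real j * (c - s x)))) * F x)
      \<longlonglongrightarrow> soft_cutoff c (s x) * F x" for x
    by (intro tendsto_intros tendsto_soft_cutoff)
  show "(\<lambda>x. soft_cutoff c (s x) * F x) integrable_on cbox u v"
    and "(\<lambda>j. integral (cbox u v) (\<lambda>x. (1 - exp (- exp (real j * (c - s x)))) * F x))
      \<longlonglongrightarrow> integral (cbox u v) (\<lambda>x. soft_cutoff c (s x) * F x)"
    using dominated_convergence[OF 1 2 3 4] by auto
qed

text \<open>Expanding \<open>exp (- exp (l * (c - s)))\<close> in powers of \<open>exp (l * (c - s))\<close> expresses the integral
  through the Laplace transform at the multiples of \<open>l\<close>.\<close>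

lemma laplace_decay_integral_bound:
  fixes s F :: "'a::euclidean_space \<Rightarrow> real"
  assumes s: "continuous_on (cbox u v) s" and F: "continuous_on (cbox u v) F"
    and s0: "\<And>x. x \<in> cbox u v \<Longrightarrow> s x \<ge> 0"
    and C: "\<And>l. l \<ge> l0 \<Longrightarrow> \<bar>integral (cbox u v) (\<lambda>x. exp (- l * s x) * F x)\<bar> \<le> C * exp (- l * a)"
    and l: "l \<ge> l0" "l \<ge> 0"
  shows "\<bar>integral (cbox u v) (\<lambda>x. (1 - exp (- exp (l * (c - s x)))) * F x)\<bar>
    \<le> C * (exp (exp (l * (c - a))) - 1)"
proof -
  define I where "I m = integral (cbox u v) (\<lambda>x. exp (- m * s x) * F x)" for m
  define q where "q = exp (l * (c - a))"
  define P where "P K x = (\<Sum>k<K. (- exp (l * (c - s x))) ^ k / fact k) * F x" for K :: nat and x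
  have P_int: "(P K) integrable_on cbox u v" for K
    unfolding P_def by (intro integrable_continuous continuous_intros assms) auto
  have int_P: "integral (cbox u v) (P K) = (\<Sum>k<K. (-1) ^ k * exp (real k * l * c) / fact k * I (real k * l))" for K
  proof -
    have "P K x = (\<Sum>k<K. (-1) ^ k * exp (real k * l * c) / fact k * (exp (- (real k * l) * s x) * F x))" for x
    proof -
      have "(- exp (l * (c - s x))) ^ k = (-1) ^ k * exp (real k * l * c) * exp (- (real k * l) * s x)" for k
        unfolding power_minus[of "exp _"] by (simp add: exp_of_nat_mult[symmetric] exp_add[symmetric] algebra_simps)
      then show ?thesis unfolding P_def sum_distrib_right by (intro sum.cong refl) simp
    qed
    then have "integral (cbox u v) (P K) = integral (cbox u v) (\<lambda>x. \<Sum>k<K. (-1) ^ k * exp (real k * l * c) / fact k * (exp (- (real k * l) * s x) * F x))"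
      by presburger
    also have "\<dots> = (\<Sum>k<K. integral (cbox u v) (\<lambda>x. (-1) ^ k * exp (real k * l * c) / fact k * (exp (- (real k * l) * s x) * F x)))"
      by (intro integral_sum integrable_continuous continuous_intros assms) auto
    also have "\<dots> = (\<Sum>k<K. (-1) ^ k * exp (real k * l * c) / fact k * I (real k * l))"
      unfolding I_def integral_mult_right ..
    finally show ?thesis .
  qed
  \<comment> \<open>The term for \<open>k = 0\<close> is \<open>I 0\<close>; it is split off because
    it cancels against the 1 in \<open>1 - exp (- exp (l * (c - s)))\<close>. The other terms sit at
    multiples of \<open>l\<close> above \<open>l0\<close>, where the decay hypothesis
    applies.\<close>
  have bound_P: "\<bar>integral (cbox u v) (P (Suc K)) - I 0\<bar> \<le> C * ((\<Sum>k<Suc K. q ^ k / fact k) - 1)" for K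
  proof -
    have term_le: "\<bar>(-1) ^ Suc k * exp (real (Suc k) * l * c) / fact (Suc k) * I (real (Suc k) * l)\<bar>
        \<le> C * (q ^ Suc k / fact (Suc k))" for k
    proof -
      have "l * 1 \<le> l * real (Suc k)" using l by (intro mult_left_mono) auto
      then have "\<bar>I (real (Suc k) * l)\<bar> \<le> C * exp (- (real (Suc k) * l) * a)"
        unfolding I_def using l by (intro C) (simp add: mult.commute)
      then have "exp (real (Suc k) * l * c) / fact (Suc k) * \<bar>I (real (Suc k) * l)\<bar>
          \<le> exp (real (Suc k) * l * c) / fact (Suc k) * (C * exp (- (real (Suc k) * l) * a))"
        by (intro mult_left_mono) auto
      also have "\<dots> = C * (exp (real (Suc k) * l * c + - (real (Suc k) * l) * a) / fact (Suc k))"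
        by (simp only: exp_add) simp
      also have "exp (real (Suc k) * l * c + - (real (Suc k) * l) * a) = q ^ Suc k"
        unfolding q_def exp_of_nat_mult[symmetric] by (simp add: algebra_simps)
      finally show ?thesis by (simp only: abs_mult abs_divide power_abs) simp
    qed
    have "integral (cbox u v) (P (Suc K)) - I 0
        = (\<Sum>k<K. (-1) ^ Suc k * exp (real (Suc k) * l * c) / fact (Suc k) * I (real (Suc k) * l))"
      unfolding int_P sum.lessThan_Suc_shift by simp
    also have "\<bar>\<dots>\<bar> \<le> (\<Sum>k<K. C * (q ^ Suc k / fact (Suc k)))"
      by (intro order_trans[OF sum_abs] sum_mono term_le)
    also have "\<dots> = C * ((\<Sum>k<Suc K. q ^ k / fact k) - 1)"
      unfolding sum.lessThan_Suc_shift by (simp add: sum_distrib_left)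
    finally show ?thesis .
  qed
  have exp_lim: "(\<lambda>K. \<Sum>k<K. x ^ k / fact k) \<longlonglongrightarrow> exp x" for x :: real
    using exp_converges[of x] by (simp add: sums_def field_simps)
  have exp_sum_le: "(\<Sum>k<K. x ^ k / fact k) \<le> exp x" if "x \<ge> 0" for x :: real and K
    using sum_le_suminf[OF summable_exp_generic[of x], of "{..<K}"] that
    by (simp add: exp_def field_simps)
  \<comment> \<open>Since \<open>s\<close> is nonnegative on the box, all partial sums are bounded
    by \<open>exp (exp (l * c))\<close>, so series and integral can be interchanged.\<close>
  have "(\<lambda>K. integral (cbox u v) (P K)) \<longlonglongrightarrow> integral (cbox u v) (\<lambda>x. exp (- exp (l * (c - s x))) * F x)"
  proof (rule dominated_convergence(2)[where h = "\<lambda>x. exp (exp (l * c)) * \<bar>F x\<bar>"])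
    show "(\<lambda>x. exp (exp (l * c)) * \<bar>F x\<bar>) integrable_on cbox u v"
      by (intro integrable_continuous continuous_intros assms)
    show "norm (P K x) \<le> exp (exp (l * c)) * \<bar>F x\<bar>" if "x \<in> cbox u v" for K x
    proof -
      let ?w = "exp (l * (c - s x))"
      have "\<bar>\<Sum>k<K. (- ?w) ^ k / fact k\<bar> \<le> (\<Sum>k<K. ?w ^ k / fact k)"
        by (rule order_trans[OF sum_abs]) (simp add: power_abs)
      also have "\<dots> \<le> exp ?w"
        by (rule exp_sum_le) simp
      also have "\<dots> \<le> exp (exp (l * c))"
        using l s0[OF that] by (simp add: algebra_simps)
      finally show ?thesis unfolding P_def by (simp add: abs_mult mult_right_mono)
    qed
    show "(\<lambda>K. P K x) \<longlonglongrightarrow> exp (- exp (l * (c - s x))) * F x" for x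
      unfolding P_def by (intro tendsto_intros exp_lim)
  qed (rule P_int)
  then have lim1: "(\<lambda>K. \<bar>integral (cbox u v) (P (Suc K)) - I 0\<bar>)
      \<longlonglongrightarrow> \<bar>integral (cbox u v) (\<lambda>x. exp (- exp (l * (c - s x))) * F x) - I 0\<bar>"
    by (intro tendsto_intros LIMSEQ_Suc)
  have lim2: "(\<lambda>K. C * ((\<Sum>k<Suc K. q ^ k / fact k) - 1)) \<longlonglongrightarrow> C * (exp q - 1)"
    by (intro tendsto_intros LIMSEQ_Suc[OF exp_lim])
  have "\<bar>integral (cbox u v) (\<lambda>x. exp (- exp (l * (c - s x))) * F x) - I 0\<bar> \<le> C * (exp q - 1)"
    using bound_P by (intro LIMSEQ_le[OF lim1 lim2]) auto
  moreover have "integral (cbox u v) (\<lambda>x. (1 - exp (- exp (l * (c - s x)))) * F x)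
      = I 0 - integral (cbox u v) (\<lambda>x. exp (- exp (l * (c - s x))) * F x)"
    unfolding I_def left_diff_distrib
    by (subst integral_diff) (auto intro!: integrable_continuous continuous_intros assms)
  ultimately show ?thesis unfolding q_def by linarith
qed

text \<open>Since \<open>c < a\<close>, the bound of \<open>laplace_decay_integral_bound\<close>
  tends to 0 along integer \<open>l\<close>, while the integrals tend to the one with the
  cutoff.\<close>

lemma integral_soft_cutoff_eq_0:
  fixes s F :: "'a::euclidean_space \<Rightarrow> real"
  assumes s: "continuous_on (cbox u v) s" and F: "continuous_on (cbox u v) F"
    and s0: "\<And>x. x \<in> cbox u v \<Longrightarrow> s x \<ge> 0"
    and C: "\<And>l. l \<ge> l0 \<Longrightarrow> \<bar>integral (cbox u v) (\<lambda>x. exp (- l * s x) * F x)\<bar> \<le> C * exp (- l * a)"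
    and "c < a"
  shows "integral (cbox u v) (\<lambda>x. soft_cutoff c (s x) * F x) = 0"
proof -
  have "filterlim (\<lambda>j. real j * (a - c)) at_top sequentially"
    using \<open>c < a\<close> by (intro filterlim_at_top_mult_tendsto_pos[OF tendsto_const] filterlim_real_sequentially) auto
  then have "filterlim (\<lambda>j. - (real j * (a - c))) at_bot sequentially"
    by (intro filterlim_compose[OF filterlim_uminus_at_bot_at_top])
  then have "(\<lambda>j. exp (- (real j * (a - c)))) \<longlonglongrightarrow> 0"
    by (intro filterlim_compose[OF exp_at_bot])
  then have "(\<lambda>j. exp (real j * (c - a))) \<longlonglongrightarrow> 0" by (simp add: algebra_simps)
  then have "(\<lambda>j. C * (exp (exp (real j * (c - a))) - 1)) \<longlonglongrightarrow> C * (exp 0 - 1)"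
    by (intro tendsto_intros)
  then have lim: "(\<lambda>j. C * (exp (exp (real j * (c - a))) - 1)) \<longlonglongrightarrow> 0" by simp
  have "(\<lambda>j. integral (cbox u v) (\<lambda>x. (1 - exp (- exp (real j * (c - s x)))) * F x)) \<longlonglongrightarrow> 0"
  proof (rule Lim_null_comparison[OF _ lim])
    show "\<forall>\<^sub>F j in sequentially. norm (integral (cbox u v) (\<lambda>x. (1 - exp (- exp (real j * (c - s x)))) * F x))
        \<le> C * (exp (exp (real j * (c - a))) - 1)"
      using eventually_ge_at_top[of "nat \<lceil>l0\<rceil>"]
    proof eventually_elim
      case (elim j)
      then have "l0 \<le> real j" by linarith
      then show ?case using laplace_decay_integral_bound[OF s F s0 C, of "real j"] by simp
    qed
  qed
  then show ?thesis using integral_soft_cutoff(2)[OF s F] LIMSEQ_unique by blast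
qed

text \<open>The monomials are the factors produced by shifting the centre of a Gaussian at
  \<open>p\<close>. Their sums form an algebra that separates points, as Stone-Weierstrass
  requires.\<close>

inductive exp_polynomial :: "'a \<Rightarrow> ('a::euclidean_space \<Rightarrow> real) \<Rightarrow> bool" for p where
  monomial: "exp_polynomial p (\<lambda>x. c * exp ((x - p) \<bullet> w))"
| add: "exp_polynomial p g \<Longrightarrow> exp_polynomial p h \<Longrightarrow> exp_polynomial p (\<lambda>x. g x + h x)"

lemma exp_polynomial_mult:
  assumes "exp_polynomial p g" "exp_polynomial p h"
  shows "exp_polynomial p (\<lambda>x. g x * h x)"
  using assms
proof (induction arbitrary: h rule: exp_polynomial.induct)
  case (monomial c w)
  from monomial show ?case
  proof (induction rule: exp_polynomial.induct)
    case (monomial c' w')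
    have "(\<lambda>x. c * exp ((x - p) \<bullet> w) * (c' * exp ((x - p) \<bullet> w')))
        = (\<lambda>x. (c * c') * exp ((x - p) \<bullet> (w + w')))"
      by (simp add: inner_add_right exp_add mult_ac)
    then show ?case by (simp only: exp_polynomial.monomial)
  next
    case (add g h)
    then show ?case unfolding distrib_left by (intro exp_polynomial.add)
  qed
next
  case (add g1 g2)
  then show ?case unfolding distrib_right by (intro exp_polynomial.add)
qed

lemma continuous_on_exp_polynomial:
  "exp_polynomial p g \<Longrightarrow> continuous_on S g"
  by (induction rule: exp_polynomial.induct) (auto intro!: continuous_intros)

lemma exp_polynomial_dense:
  fixes f :: "'a::euclidean_space \<Rightarrow> real"
  assumes "compact S" "continuous_on S f" "e > 0"
  obtains g where "exp_polynomial p g" "\<And>x. x \<in> S \<Longrightarrow> \<bar>f x - g x\<bar> < e"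
proof -
  have "\<exists>g. exp_polynomial p g \<and> (\<forall>x\<in>S. \<bar>f x - g x\<bar> < e)"
  proof (rule Stone_Weierstrass_HOL)
    show "exp_polynomial p (\<lambda>x. c)" for c
      using exp_polynomial.monomial[of p c 0] by simp
    show "\<exists>f. exp_polynomial p f \<and> f x \<noteq> f y" if "x \<in> S \<and> y \<in> S \<and> x \<noteq> y" for x y
    proof (intro exI conjI)
      show "exp_polynomial p (\<lambda>z. 1 * exp ((z - p) \<bullet> (x - y)))" by (rule exp_polynomial.monomial)
      have "(x - p) \<bullet> (x - y) - (y - p) \<bullet> (x - y) = (x - y) \<bullet> (x - y)"
        by (simp add: inner_diff_left)
      then have "(x - p) \<bullet> (x - y) \<noteq> (y - p) \<bullet> (x - y)"
        using that by auto
      then show "1 * exp ((x - p) \<bullet> (x - y)) \<noteq> 1 * exp ((y - p) \<bullet> (x - y))" by simp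
    qed
  qed (use assms in \<open>auto intro: exp_polynomial.add exp_polynomial_mult continuous_on_exp_polynomial\<close>)
  then show ?thesis using that by blast
qed

text \<open>Moving the centre by \<open>w / (2 * l)\<close> multiplies the Gaussian \<open>exp (- l * (norm (x - p))\<^sup>2)\<close> by
  \<open>exp ((x - p) \<bullet> w)\<close> up to a constant, so decay for all centres near \<open>p\<close> yields decay for \<open>f\<close>
  multiplied by any exponential.\<close>

lemma gaussian_transform_decay_imp_eq_0:
  fixes f :: "'a::euclidean_space \<Rightarrow> real"
  assumes f: "continuous_on (cbox u v) f" and ne: "box u v \<noteq> {}" and "e > 0"
    and decay: "\<And>q l. q \<in> ball p e \<Longrightarrow> l \<ge> l0 \<Longrightarrow>
      \<bar>integral (cbox u v) (\<lambda>x. exp (- l * (norm (x - q))\<^sup>2) * f x)\<bar> \<le> C * exp (- l * a)"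
    and x0: "x0 \<in> cbox u v" "(norm (x0 - p))\<^sup>2 < a"
  shows "f x0 = 0"
proof -
  define s where "s x = (norm (x - p))\<^sup>2" for x
  have s: "continuous_on (cbox u v) s" unfolding s_def by (intro continuous_intros)
  \<comment> \<open>\<open>c < a\<close> makes the cutoff integrals vanish; \<open>s x0 < c\<close>
    puts \<open>x0\<close> where the cutoff equals 1.\<close>
  obtain c where c: "s x0 < c" "c < a" using x0(2) dense unfolding s_def by blast
  have "c > 0" using c(1) zero_le_power2[of "norm (x0 - p)"] unfolding s_def by linarith
  define \<theta> where "\<theta> x = soft_cutoff c (s x)" for x
  have \<theta>01: "0 \<le> \<theta> x" "\<theta> x \<le> 1" for x unfolding \<theta>_def soft_cutoff_def by auto
  have "0 \<le> C * exp (- l0 * a)"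
    using decay[of p l0] \<open>e > 0\<close> by (intro order_trans[OF abs_ge_zero]) auto
  then have "C \<ge> 0" by (simp add: zero_le_mult_iff)
  have int: "(\<lambda>x. \<theta> x * F x) integrable_on cbox u v" if "continuous_on (cbox u v) F" for F
    unfolding \<theta>_def by (rule integral_soft_cutoff(1)[OF s that])
  have exp0: "integral (cbox u v) (\<lambda>x. \<theta> x * (exp ((x - p) \<bullet> w) * f x)) = 0" for w
    unfolding \<theta>_def
  proof (rule integral_soft_cutoff_eq_0[OF s])
    show "continuous_on (cbox u v) (\<lambda>x. exp ((x - p) \<bullet> w) * f x)" by (intro continuous_intros f)
    \<comment> \<open>\<open>l \<ge> norm w / e\<close> keeps the shifted centre in
      \<open>ball p e\<close>; \<open>l \<ge> 1\<close> bounds the factor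
      \<open>exp ((norm w)\<^sup>2 / (4 * l))\<close> independently of \<open>l\<close>.\<close>
    show "\<bar>integral (cbox u v) (\<lambda>x. exp (- l * s x) * (exp ((x - p) \<bullet> w) * f x))\<bar>
        \<le> (exp ((norm w)\<^sup>2) * C) * exp (- l * a)" if l: "l \<ge> max 1 (max l0 (norm w / e))" for l
    proof -
      have l': "l \<ge> 1" "l \<ge> l0" "norm w / e \<le> l" using l by auto
      define q where "q = p + (1 / (2 * l)) *\<^sub>R w"
      have "dist p q = norm w / (2 * l)" using l' by (simp add: q_def dist_norm)
      also have "\<dots> < e"
      proof -
        have "norm w \<le> l * e" using l'(3) \<open>e > 0\<close> by (simp add: field_simps)
        moreover have "0 < l * e" using l' \<open>e > 0\<close> by simp
        ultimately have "norm w < 2 * (l * e)" by linarith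
        then show ?thesis using l' by (simp add: field_simps)
      qed
      finally have "q \<in> ball p e" by simp
      \<comment> \<open>Completing the square in the exponent.\<close>
      have "exp (- l * s x) * (exp ((x - p) \<bullet> w) * f x)
          = exp ((norm w)\<^sup>2 / (4 * l)) * (exp (- l * (norm (x - q))\<^sup>2) * f x)" for x
      proof -
        have "(norm (x - q))\<^sup>2 = s x - ((x - p) \<bullet> w) / l + (norm w)\<^sup>2 / (4 * l\<^sup>2)"
        proof -
          have "x - q = (x - p) - (1 / (2 * l)) *\<^sub>R w" by (simp add: q_def)
          then have "(norm (x - q))\<^sup>2 = ((x - p) - (1 / (2 * l)) *\<^sub>R w) \<bullet> ((x - p) - (1 / (2 * l)) *\<^sub>R w)"
            by (simp only: power2_norm_eq_inner)
          also have "\<dots> = (x - p) \<bullet> (x - p) - ((x - p) \<bullet> w) / l + (w \<bullet> w) / (4 * l\<^sup>2)"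
            unfolding inner_diff_left[of "x - p"] inner_diff_right[of _ "x - p"] inner_scaleR_left inner_scaleR_right
              inner_commute[of w "x - p"]
            using l' by (simp add: field_simps power2_eq_square)
          finally show ?thesis unfolding s_def power2_norm_eq_inner .
        qed
        then have eq: "- l * s x + (x - p) \<bullet> w = (norm w)\<^sup>2 / (4 * l) + - l * (norm (x - q))\<^sup>2"
          using l' by (simp only:) (simp add: field_simps power2_eq_square)
        then show ?thesis by (simp only: mult.assoc[symmetric] exp_add[symmetric])
      qed
      then have "integral (cbox u v) (\<lambda>x. exp (- l * s x) * (exp ((x - p) \<bullet> w) * f x))
          = exp ((norm w)\<^sup>2 / (4 * l)) * integral (cbox u v) (\<lambda>x. exp (- l * (norm (x - q))\<^sup>2) * f x)"
        by (simp only: integral_mult_right)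
      also have "\<bar>\<dots>\<bar> \<le> exp ((norm w)\<^sup>2 / (4 * l)) * (C * exp (- l * a))"
        unfolding abs_mult abs_exp_cancel
        using decay[OF \<open>q \<in> ball p e\<close> l'(2)] by (intro mult_left_mono) auto
      also have "\<dots> \<le> exp ((norm w)\<^sup>2) * (C * exp (- l * a))"
      proof (intro mult_right_mono)
        have "(norm w)\<^sup>2 / (4 * l) \<le> (norm w)\<^sup>2 / 1"
          using l' by (intro divide_left_mono) auto
        then show "exp ((norm w)\<^sup>2 / (4 * l)) \<le> exp ((norm w)\<^sup>2)" by simp
      qed (use \<open>C \<ge> 0\<close> in auto)
      finally show ?thesis by (simp add: mult.assoc)
    qed
  qed (use c in \<open>auto simp: s_def\<close>)
  have poly0: "integral (cbox u v) (\<lambda>x. \<theta> x * (g x * f x)) = 0" if "exp_polynomial p g" for g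
    using that
  proof (induction rule: exp_polynomial.induct)
    case (monomial c w)
    have "(\<lambda>x. \<theta> x * (c * exp ((x - p) \<bullet> w) * f x)) = (\<lambda>x. c * (\<theta> x * (exp ((x - p) \<bullet> w) * f x)))"
      by (auto simp: mult_ac)
    then show ?case by (simp only: integral_mult_right exp0)
  next
    case (add g h)
    have "(\<lambda>x. \<theta> x * (g x * f x)) integrable_on cbox u v" "(\<lambda>x. \<theta> x * (h x * f x)) integrable_on cbox u v"
      using add.hyps[THEN continuous_on_exp_polynomial] by (auto intro!: int continuous_intros f)
    then show ?case using add.IH by (simp add: distrib_left distrib_right integral_add)
  qed
  define J where "J = integral (cbox u v) (\<lambda>x. \<bar>f x\<bar>)"
  have "J \<ge> 0" unfolding J_def by (intro integral_nonneg integrable_continuous continuous_intros f) auto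
  \<comment> \<open>One factor of \<open>f * f\<close> is approximated uniformly by an exponential
    polynomial, whose integral against \<open>\<theta>\<close> and \<open>f\<close> is 0 by
    \<open>poly0\<close>.\<close>
  have le: "integral (cbox u v) (\<lambda>x. \<theta> x * (f x * f x)) \<le> \<delta> * J" if \<delta>: "\<delta> > 0" for \<delta>
  proof -
    obtain g where g: "exp_polynomial p g" "\<And>x. x \<in> cbox u v \<Longrightarrow> \<bar>f x - g x\<bar> < \<delta>"
      using exp_polynomial_dense[OF compact_cbox f \<delta>] by blast
    have cg: "continuous_on (cbox u v) g" using g(1) by (rule continuous_on_exp_polynomial)
    have "integral (cbox u v) (\<lambda>x. \<theta> x * (f x * f x))
        = integral (cbox u v) (\<lambda>x. \<theta> x * (f x * f x) - \<theta> x * (g x * f x))"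
      by (subst integral_diff) (auto intro!: int continuous_intros f cg simp: poly0[OF g(1)])
    also have "\<dots> \<le> integral (cbox u v) (\<lambda>x. \<delta> * \<bar>f x\<bar>)"
    proof (rule integral_le)
      show "\<theta> x * (f x * f x) - \<theta> x * (g x * f x) \<le> \<delta> * \<bar>f x\<bar>" if "x \<in> cbox u v" for x
      proof -
        have "\<theta> x * (f x * f x) - \<theta> x * (g x * f x) = \<theta> x * ((f x - g x) * f x)"
          by (simp add: algebra_simps)
        also have "\<dots> \<le> \<bar>\<theta> x * ((f x - g x) * f x)\<bar>" by simp
        also have "\<dots> \<le> 1 * (\<delta> * \<bar>f x\<bar>)"
          unfolding abs_mult using \<theta>01[of x] g(2)[OF that] by (intro mult_mono) auto
        finally show ?thesis by simp
      qed
    qed (intro integrable_diff int integrable_continuous continuous_intros f cg)+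
    finally show ?thesis by (simp add: J_def)
  qed
  have le0: "integral (cbox u v) (\<lambda>x. \<theta> x * (f x * f x)) \<le> 0"
  proof (rule field_le_epsilon)
    fix d :: real assume "d > 0"
    have "integral (cbox u v) (\<lambda>x. \<theta> x * (f x * f x)) \<le> d / (J + 1) * J"
      using \<open>d > 0\<close> \<open>J \<ge> 0\<close> by (intro le) auto
    also have "\<dots> \<le> d" using \<open>d > 0\<close> \<open>J \<ge> 0\<close> by (simp add: field_simps)
    finally show "integral (cbox u v) (\<lambda>x. \<theta> x * (f x * f x)) \<le> 0 + d" by simp
  qed
  \<comment> \<open>\<open>\<theta>\<close> is discontinuous, so the vanishing of the integral is
    passed on to a continuous nonnegative function below \<open>c * \<theta> * f\<^sup>2\<close>,
    which can then be evaluated at \<open>x0\<close>.\<close>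
  define \<phi> where "\<phi> x = max 0 (c - s x) * (f x * f x)" for x
  have c\<phi>: "continuous_on (cbox u v) \<phi>" unfolding \<phi>_def by (intro continuous_intros f s)
  have "\<phi> x \<ge> 0" for x unfolding \<phi>_def by auto
  have "integral (cbox u v) \<phi> \<le> integral (cbox u v) (\<lambda>x. c * (\<theta> x * (f x * f x)))"
  proof (rule integral_le)
    show "\<phi> x \<le> c * (\<theta> x * (f x * f x))" for x
    proof -
      have "max 0 (c - s x) \<le> c * \<theta> x"
        using \<open>c > 0\<close> \<theta>01[of x] unfolding \<theta>_def soft_cutoff_def by (auto simp: s_def)
      from mult_right_mono[OF this, of "f x * f x"] show ?thesis
        unfolding \<phi>_def by (simp add: mult.assoc)
    qed
  qed (auto intro!: integrable_continuous c\<phi> integrable_on_mult_right int continuous_intros f)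
  also have "\<dots> = c * integral (cbox u v) (\<lambda>x. \<theta> x * (f x * f x))" by (rule integral_mult_right)
  also have "\<dots> \<le> 0" using le0 \<open>c > 0\<close> by (simp add: mult_le_0_iff)
  finally have "integral (cbox u v) \<phi> = 0"
    using integral_nonneg[OF integrable_continuous[OF c\<phi>]] \<open>\<And>x. \<phi> x \<ge> 0\<close> by force
  then have "(\<phi> has_integral 0) (cbox u v)"
    using integrable_integral[OF integrable_continuous[OF c\<phi>]] by simp
  then have "\<phi> x0 = 0"
    using has_integral_0_cbox_imp_0[OF c\<phi>] \<open>\<And>x. \<phi> x \<ge> 0\<close> ne x0(1) by blast
  then show ?thesis using c(1) unfolding \<phi>_def by auto
qed

subsection \<open>Maximum principle and barrier\<close>

text \<open>If \<open>d\<close> were positive, then \<open>\<phi>'\<close>, which vanishes at the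
  maximum, would be positive just to the right of 0, and \<open>\<phi>\<close> would increase there
  by the mean value theorem.\<close>

lemma second_derivative_le_0_at_local_max:
  fixes \<phi> :: "real \<Rightarrow> real"
  assumes "e > 0" and max: "\<And>s. \<bar>s\<bar> < e \<Longrightarrow> \<phi> s \<le> \<phi> 0"
    and d1: "\<And>s. (\<phi> has_real_derivative \<phi>' s) (at s)"
    and d2: "(\<phi>' has_real_derivative d) (at 0)"
  shows "d \<le> 0"
proof (rule ccontr)
  assume "\<not> d \<le> 0"
  then obtain \<delta> where \<delta>: "\<delta> > 0" "\<And>h. 0 < h \<Longrightarrow> h < \<delta> \<Longrightarrow> \<phi>' 0 < \<phi>' (0 + h)"
    using DERIV_pos_inc_right[OF d2] by auto
  have "\<phi>' 0 = 0"
    using DERIV_local_max[OF d1[of 0] \<open>e > 0\<close>] max by simp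
  define h where "h = min \<delta> e / 2"
  have h: "0 < h" "h < \<delta>" "h < e" using \<delta>(1) \<open>e > 0\<close> by (auto simp: h_def)
  obtain z where z: "0 < z" "z < h" "\<phi> h - \<phi> 0 = (h - 0) * \<phi>' z"
    using MVT2[of 0 h \<phi> \<phi>'] h(1) d1 by blast
  have "\<phi>' z > 0" using \<delta>(2)[of z] z h \<open>\<phi>' 0 = 0\<close> by auto
  then have "\<phi> h > \<phi> 0" using z(3) h(1) by (simp add: algebra_simps)
  then show False using max[of h] h by auto
qed

text \<open>One-sided, because the maximum in \<open>heat_maximum_principle\<close> may be attained
  at the lower end \<open>l0\<close>, from where \<open>l\<close> can only increase.\<close>

lemma derivative_le_0_at_right_max:
  fixes \<phi> :: "real \<Rightarrow> real"
  assumes d: "(\<phi> has_real_derivative d) (at t)" and "t < b"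
    and max: "\<And>s. t \<le> s \<Longrightarrow> s \<le> b \<Longrightarrow> \<phi> s \<le> \<phi> t"
  shows "d \<le> 0"
proof (rule ccontr)
  assume "\<not> d \<le> 0"
  then obtain \<delta> where \<delta>: "\<delta> > 0" "\<And>h. 0 < h \<Longrightarrow> h < \<delta> \<Longrightarrow> \<phi> t < \<phi> (t + h)"
    using DERIV_pos_inc_right[OF d] by auto
  define h where "h = min \<delta> (b - t) / 2"
  have h: "0 < h" "h < \<delta>" "t + h \<le> b" using \<delta>(1) \<open>t < b\<close> by (auto simp: h_def min_def field_simps)
  then show False using \<delta>(2)[of h] max[of "t + h"] by auto
qed

text \<open>With \<open>t = 1 / (4 * l)\<close>, the operator in \<open>sub\<close> is the Laplacian minus \<open>\<partial>/\<partial>t\<close>, conjugated by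
  \<open>t powr (DIM('a) / 2)\<close>. The weight \<open>l ^ DIM('a)\<close> gives its zero-order term the sign needed for the
  maximum principle.\<close>

lemma heat_maximum_principle:
  fixes D Dl :: "'a::euclidean_space \<Rightarrow> real \<Rightarrow> real"
    and D1 :: "'a \<Rightarrow> 'a \<Rightarrow> real \<Rightarrow> real \<Rightarrow> real" and D2 :: "'a \<Rightarrow> 'a \<Rightarrow> real \<Rightarrow> real"
    and l0 L l \<kappa> :: real
  assumes K: "compact K" "open I" "I \<subseteq> K" and l0: "0 < l0"
    and cont: "continuous_on (K \<times> {l0..L}) (\<lambda>(p, l). D p l)"
    and Dl: "\<And>p (l::real). l > 0 \<Longrightarrow> (D p has_real_derivative Dl p l) (at l)"
    and D1: "\<And>p (l::real) b (s::real). b \<in> Basis \<Longrightarrow> ((\<lambda>s. D (p + s *\<^sub>R b) l) has_real_derivative D1 b p l s) (at s)"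
    and D2: "\<And>p (l::real) b. b \<in> Basis \<Longrightarrow> (D1 b p l has_real_derivative D2 b p l) (at 0)"
    and sub: "\<And>p (l::real). p \<in> I \<Longrightarrow> l0 \<le> l \<Longrightarrow>
      0 \<le> (\<Sum>b\<in>Basis. D2 b p l) + 4 * l\<^sup>2 * Dl p l + 2 * DIM('a) * l * D p l"
    and bd: "\<And>p (l::real). p \<in> K - I \<Longrightarrow> l0 \<le> l \<Longrightarrow> l \<le> L \<Longrightarrow> l ^ DIM('a) * D p l \<le> \<kappa>"
    and bdL: "\<And>p. p \<in> K \<Longrightarrow> L ^ DIM('a) * D p L \<le> \<kappa>"
    and "\<kappa> \<ge> 0"
    and pl: "p \<in> K" "l0 \<le> l" "l \<le> L"
  shows "l ^ DIM('a) * D p l \<le> \<kappa>"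
proof (rule ccontr)
  assume neg: "\<not> l ^ DIM('a) * D p l \<le> \<kappa>"
  define n where "n = DIM('a)"
  have "n > 0" unfolding n_def by simp
  define y where "y = (\<lambda>(p, l). l ^ n * D p l)"
  have "continuous_on (K \<times> {l0..L}) (\<lambda>z. snd z ^ n * (\<lambda>(p, l). D p l) z)"
    by (intro continuous_intros cont)
  then have "continuous_on (K \<times> {l0..L}) y" by (simp add: y_def case_prod_beta)
  moreover have "compact (K \<times> {l0..L})" using K by (intro compact_Times) auto
  moreover have "K \<times> {l0..L} \<noteq> {}" using pl by auto
  ultimately obtain z where z: "z \<in> K \<times> {l0..L}" "\<And>w. w \<in> K \<times> {l0..L} \<Longrightarrow> y w \<le> y z"
    using continuous_attains_sup by metis
  obtain q m where qm: "z = (q, m)" by fastforce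
  have q: "q \<in> K" "l0 \<le> m" "m \<le> L" using z(1) qm by auto
  have mx: "l ^ n * D p l \<le> m ^ n * D q m" if "p \<in> K" "l0 \<le> l" "l \<le> L" for p l
    using z(2)[of "(p, l)"] that qm by (simp add: y_def)
  have big: "m ^ n * D q m > \<kappa>" using mx[OF pl] neg unfolding n_def by linarith
  then have "0 < m ^ n * D q m" using \<open>\<kappa> \<ge> 0\<close> by linarith
  moreover have "0 < m ^ n" using q l0 by simp
  ultimately have "D q m > 0" using zero_less_mult_pos by blast
  \<comment> \<open>A maximum above \<open>\<kappa>\<close> avoids the parabolic boundary. Time runs
    as \<open>1 / l\<close>, so \<open>l = L\<close> is the initial slice; the maximum may still lie
    on the final slice \<open>l = l0\<close>.\<close>
  have "q \<in> I" using bd[of q m] q big unfolding n_def by force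
  have "m < L" using bdL[of q] q big unfolding n_def by (cases "m = L") auto
  have "m > 0" using q l0 by simp
  have lap: "D2 b q m \<le> 0" if b: "b \<in> Basis" for b
  proof -
    obtain e where e: "e > 0" "ball q e \<subseteq> I" using \<open>open I\<close> \<open>q \<in> I\<close> openE by blast
    show ?thesis
    proof (rule second_derivative_le_0_at_local_max[OF e(1) _ D1[OF b] D2[OF b]])
      fix s :: real assume "\<bar>s\<bar> < e"
      then have "q + s *\<^sub>R b \<in> ball q e" using b by (simp add: dist_norm)
      then have "q + s *\<^sub>R b \<in> K" using e K by blast
      then have "m ^ n * D (q + s *\<^sub>R b) m \<le> m ^ n * D q m" using q by (intro mx)
      then show "D (q + s *\<^sub>R b) m \<le> D (q + 0 *\<^sub>R b) m"
        using \<open>m > 0\<close> by simp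
    qed
  qed
  have "((\<lambda>l. l ^ n * D q l) has_real_derivative real n * m ^ (n - 1) * D q m + m ^ n * Dl q m) (at m)"
    using Dl[OF \<open>m > 0\<close>, of q] by (auto intro!: derivative_eq_intros)
  then have "real n * m ^ (n - 1) * D q m + m ^ n * Dl q m \<le> 0"
    using \<open>m < L\<close> by (rule derivative_le_0_at_right_max) (use q mx in auto)
  moreover have "m ^ n = m * m ^ (n - 1)" using \<open>n > 0\<close> by (simp add: power_eq_if)
  ultimately have "m ^ (n - 1) * (real n * D q m + m * Dl q m) \<le> 0" by (simp add: algebra_simps)
  then have "real n * D q m + m * Dl q m \<le> 0" using \<open>m > 0\<close> by (metis mult_pos_pos not_le zero_less_power)
  then have "4 * m * (real n * D q m + m * Dl q m) \<le> 0"
    using \<open>m > 0\<close> by (simp add: mult_le_0_iff)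
  \<comment> \<open>The derivative of the weight contributes \<open>4 * n * m * D q m\<close>, twice
    the zero-order term, which thereby changes sign.\<close>
  then have "4 * m\<^sup>2 * Dl q m + 2 * n * m * D q m \<le> - (2 * n * m * D q m)"
    by (simp add: algebra_simps power2_eq_square)
  moreover have "0 < 2 * n * m * D q m" using \<open>n > 0\<close> \<open>m > 0\<close> \<open>D q m > 0\<close> by simp
  moreover have "(\<Sum>b\<in>Basis. D2 b q m) \<le> 0" using lap by (intro sum_nonpos)
  ultimately show False using sub[OF \<open>q \<in> I\<close> q(2)] unfolding n_def by linarith
qed

section \<open>The Gaussian transform as a solution of the heat equation\<close>

definition gaussian_transform :: "'a \<Rightarrow> 'a \<Rightarrow> ('a::euclidean_space \<Rightarrow> real) \<Rightarrow> 'a \<Rightarrow> real \<Rightarrow> real" where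
  "gaussian_transform u v f p l = integral (cbox u v) (\<lambda>x. exp (- l * (norm (x - p))\<^sup>2) * f x)"

lemma norm_add_scaleR_Basis:
  fixes x b :: "'a::euclidean_space"
  assumes "b \<in> Basis"
  shows "(norm (x + s *\<^sub>R b))\<^sup>2 = (norm x)\<^sup>2 + 2 * s * (x \<bullet> b) + s\<^sup>2"
proof -
  have "b \<bullet> b = 1" using assms by simp
  then show ?thesis
    unfolding power2_norm_eq_inner
    by (simp add: inner_add_left inner_add_right inner_commute[of b x] power2_eq_square algebra_simps)
qed

lemma norm_shift_Basis:
  fixes x p b :: "'a::euclidean_space"
  assumes "b \<in> Basis"
  shows "(norm (x - (p + s *\<^sub>R b)))\<^sup>2 = (norm (x - p))\<^sup>2 - 2 * s * ((x - p) \<bullet> b) + s\<^sup>2"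
  using norm_add_scaleR_Basis[OF assms, of "x - p" "- s"] by (simp add: algebra_simps)

lemma norm_power2_eq_sum_Basis:
  fixes x :: "'a::euclidean_space"
  shows "(norm x)\<^sup>2 = (\<Sum>b\<in>Basis. (x \<bullet> b)\<^sup>2)"
  unfolding power2_norm_eq_inner by (subst euclidean_inner) (simp add: power2_eq_square)

context
  fixes u v :: "'a::euclidean_space" and f :: "'a \<Rightarrow> real"
  assumes f: "continuous_on (cbox u v) f"
begin

lemma continuous_on_cbox_snd: "continuous_on (S \<times> cbox u v) (\<lambda>z. f (snd z))"
  by (rule continuous_on_compose2[OF f continuous_on_snd[OF continuous_on_id]]) auto

lemma continuous_on_gaussian_transform:
  "continuous_on S (\<lambda>(p, l). gaussian_transform u v f p l)"
  unfolding gaussian_transform_def case_prod_beta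
  by (rule integral_continuous_on_param)
    (auto simp: case_prod_beta intro!: continuous_intros continuous_on_cbox_snd)

lemma gaussian_transform_deriv_scale:
  "(gaussian_transform u v f p has_real_derivative
    integral (cbox u v) (\<lambda>x. - (norm (x - p))\<^sup>2 * exp (- l * (norm (x - p))\<^sup>2) * f x)) (at l)"
  unfolding gaussian_transform_def
  by (rule leibniz_rule_field_derivative[where U = UNIV])
    (auto simp: case_prod_beta intro!: derivative_eq_intros integrable_continuous continuous_intros f
      continuous_on_cbox_snd)

text \<open>The centre moves along a coordinate line, so the Leibniz rule for one real parameter
  suffices; the exponent is quadratic in \<open>s\<close>.\<close>

lemma gaussian_transform_deriv_centre:
  assumes b: "b \<in> Basis"
  shows "((\<lambda>s. gaussian_transform u v f (p + s *\<^sub>R b) l) has_real_derivative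
    integral (cbox u v) (\<lambda>x. 2 * l * ((x - p) \<bullet> b - s) * exp (- l * (norm (x - (p + s *\<^sub>R b)))\<^sup>2) * f x)) (at s)"
  unfolding gaussian_transform_def norm_shift_Basis[OF b]
  by (rule leibniz_rule_field_derivative[where U = UNIV])
    (auto simp: case_prod_beta algebra_simps intro!: derivative_eq_intros integrable_continuous continuous_intros f
      continuous_on_cbox_snd)

lemma gaussian_transform_deriv2_centre:
  assumes b: "b \<in> Basis"
  shows "((\<lambda>s. integral (cbox u v) (\<lambda>x. 2 * l * ((x - p) \<bullet> b - s) * exp (- l * (norm (x - (p + s *\<^sub>R b)))\<^sup>2) * f x))
    has_real_derivative
    integral (cbox u v) (\<lambda>x. (4 * l\<^sup>2 * ((x - p) \<bullet> b)\<^sup>2 - 2 * l) * exp (- l * (norm (x - p))\<^sup>2) * f x)) (at 0)"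
proof -
  have "((\<lambda>s. integral (cbox u v) (\<lambda>x. 2 * l * ((x - p) \<bullet> b - s) * exp (- l * (norm (x - (p + s *\<^sub>R b)))\<^sup>2) * f x))
    has_real_derivative
    integral (cbox u v) (\<lambda>x. (4 * l\<^sup>2 * ((x - p) \<bullet> b - 0)\<^sup>2 - 2 * l) * exp (- l * (norm (x - (p + 0 *\<^sub>R b)))\<^sup>2) * f x)) (at 0)"
    unfolding norm_shift_Basis[OF b]
    by (rule leibniz_rule_field_derivative[where U = UNIV and
        fx = "\<lambda>s x. (4 * l\<^sup>2 * ((x - p) \<bullet> b - s)\<^sup>2 - 2 * l) *
          exp (- l * ((norm (x - p))\<^sup>2 - 2 * s * ((x - p) \<bullet> b) + s\<^sup>2)) * f x"])
      (auto simp: case_prod_beta algebra_simps power2_eq_square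
        intro!: derivative_eq_intros integrable_continuous continuous_intros f continuous_on_cbox_snd)
  then show ?thesis by simp
qed

text \<open>The identity holds pointwise under the integral: the squares
  \<open>((x - p) \<bullet> b)\<^sup>2\<close> add up to \<open>(norm (x - p))\<^sup>2\<close>, and
  the terms \<open>- 2 * l\<close> cancel the zero-order term.\<close>

lemma gaussian_transform_heat_equation:
  fixes l :: real
  shows "(\<Sum>b\<in>Basis. integral (cbox u v) (\<lambda>x. (4 * l\<^sup>2 * ((x - p) \<bullet> b)\<^sup>2 - 2 * l) * exp (- l * (norm (x - p))\<^sup>2) * f x))
    + 4 * l\<^sup>2 * integral (cbox u v) (\<lambda>x. - (norm (x - p))\<^sup>2 * exp (- l * (norm (x - p))\<^sup>2) * f x)
    + 2 * DIM('a) * l * gaussian_transform u v f p l = 0"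
proof -
  have sum_eq: "(\<Sum>b\<in>Basis. (4 * l\<^sup>2 * ((x - p) \<bullet> b)\<^sup>2 - 2 * l) * E)
      = 4 * l\<^sup>2 * (norm (x - p))\<^sup>2 * E - 2 * DIM('a) * l * E" for x and E :: real
  proof -
    note norm_power2_eq_sum_Basis[of "x - p"]
    then show ?thesis
      unfolding left_diff_distrib sum_subtractf
      by (simp add: sum_distrib_left sum_distrib_right mult_ac)
  qed
  have "(\<Sum>b\<in>Basis. integral (cbox u v) (\<lambda>x. (4 * l\<^sup>2 * ((x - p) \<bullet> b)\<^sup>2 - 2 * l) * exp (- l * (norm (x - p))\<^sup>2) * f x))
      = integral (cbox u v) (\<lambda>x. \<Sum>b\<in>Basis. (4 * l\<^sup>2 * ((x - p) \<bullet> b)\<^sup>2 - 2 * l) * (exp (- l * (norm (x - p))\<^sup>2) * f x))"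
    unfolding mult.assoc[of "4 * l\<^sup>2 * _ - 2 * l"]
    by (rule integral_sum[symmetric]) (auto intro!: integrable_continuous continuous_intros f)
  also have "\<dots> = integral (cbox u v) (\<lambda>x. (- (4 * l\<^sup>2)) * (- (norm (x - p))\<^sup>2 * exp (- l * (norm (x - p))\<^sup>2) * f x)
        - 2 * DIM('a) * l * (exp (- l * (norm (x - p))\<^sup>2) * f x))"
    unfolding sum_eq by (simp add: mult_ac)
  also have "\<dots> = - (4 * l\<^sup>2) * integral (cbox u v) (\<lambda>x. - (norm (x - p))\<^sup>2 * exp (- l * (norm (x - p))\<^sup>2) * f x)
        - 2 * DIM('a) * l * gaussian_transform u v f p l"
    unfolding gaussian_transform_def integral_mult_right[symmetric]
    by (rule integral_diff) (auto intro!: integrable_continuous continuous_intros f)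
  finally show ?thesis by simp
qed

end

text \<open>The decay rate is a cone with vertex \<open>p0\<close>, rounded off by
  \<open>\<beta>\<close> so as to be smooth there. For \<open>B \<ge> 0\<close> its slope is at most
  \<open>2 * B\<close>, so up to lower-order terms the barrier is a supersolution wherever the rate
  exceeds \<open>B\<^sup>2\<close>.\<close>

definition barrier :: "'a::euclidean_space \<Rightarrow> real \<Rightarrow> real \<Rightarrow> real \<Rightarrow> 'a \<Rightarrow> real \<Rightarrow> real" where
  "barrier p0 A B \<beta> p l = exp (- l * (A - 2 * B * sqrt ((norm (p - p0))\<^sup>2 + \<beta>\<^sup>2)))"

lemma has_derivative_sqrt_quadratic:
  fixes k x :: real
  assumes "k + 2 * s * x + s\<^sup>2 > 0"
  shows "((\<lambda>s. sqrt (k + 2 * s * x + s\<^sup>2)) has_real_derivative (x + s) / sqrt (k + 2 * s * x + s\<^sup>2)) (at s)"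
proof -
  have "inverse q / 2 * (2 * x + 2 * s) = (x + s) * inverse q" for q :: real by algebra
  then have eq: "inverse q / 2 * (2 * x + 2 * s) = (x + s) / q" for q :: real
    by (simp only: divide_inverse)
  have "((\<lambda>s. k + 2 * s * x + s\<^sup>2) has_real_derivative 2 * x + 2 * s) (at s)"
    by (auto intro!: derivative_eq_intros)
  from DERIV_chain2[where f = sqrt and g = "\<lambda>s. k + 2 * s * x + s\<^sup>2", OF DERIV_real_sqrt[OF assms] this]
  show ?thesis by (simp only: eq)
qed

lemma barrier_shift_Basis:
  assumes "b \<in> Basis"
  shows "barrier p0 A B \<beta> (p + s *\<^sub>R b) l
    = exp (- l * (A - 2 * B * sqrt (((norm (p - p0))\<^sup>2 + \<beta>\<^sup>2) + 2 * s * ((p - p0) \<bullet> b) + s\<^sup>2)))"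
  using norm_add_scaleR_Basis[OF assms, of "p - p0" s] unfolding barrier_def by (simp add: algebra_simps)

lemma shift_Basis_pos:
  assumes "b \<in> Basis" "\<beta> > 0"
  shows "((norm (p - p0))\<^sup>2 + \<beta>\<^sup>2) + 2 * s * ((p - p0) \<bullet> b) + s\<^sup>2 > 0"
proof -
  have "(norm ((p - p0) + s *\<^sub>R b))\<^sup>2 + \<beta>\<^sup>2 > 0" using \<open>\<beta> > 0\<close> by (simp add: add_nonneg_pos)
  then show ?thesis using norm_add_scaleR_Basis[OF assms(1), of "p - p0" s] by linarith
qed

lemma barrier_deriv_scale:
  "(barrier p0 A B \<beta> p has_real_derivative
    - (A - 2 * B * sqrt ((norm (p - p0))\<^sup>2 + \<beta>\<^sup>2)) * barrier p0 A B \<beta> p l) (at l)"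
  unfolding barrier_def by (auto intro!: derivative_eq_intros)

lemma barrier_deriv_centre:
  assumes b: "b \<in> Basis" and "\<beta> > 0"
  shows "((\<lambda>s. barrier p0 A B \<beta> (p + s *\<^sub>R b) l) has_real_derivative
    2 * l * B * (((p - p0) \<bullet> b + s) / sqrt (((norm (p - p0))\<^sup>2 + \<beta>\<^sup>2) + 2 * s * ((p - p0) \<bullet> b) + s\<^sup>2))
      * barrier p0 A B \<beta> (p + s *\<^sub>R b) l) (at s)"
  unfolding barrier_shift_Basis[OF b]
  by (rule derivative_eq_intros refl has_derivative_sqrt_quadratic[OF shift_Basis_pos[OF assms]])+ simp

lemma barrier_deriv2_centre:
  assumes b: "b \<in> Basis" and "\<beta> > 0" and m: "m = sqrt ((norm (p - p0))\<^sup>2 + \<beta>\<^sup>2)"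
  shows "((\<lambda>s. 2 * l * B * (((p - p0) \<bullet> b + s) / sqrt (((norm (p - p0))\<^sup>2 + \<beta>\<^sup>2) + 2 * s * ((p - p0) \<bullet> b) + s\<^sup>2))
      * barrier p0 A B \<beta> (p + s *\<^sub>R b) l) has_real_derivative
    (2 * l * B * (1 / m - ((p - p0) \<bullet> b)\<^sup>2 / m ^ 3) + 4 * l\<^sup>2 * B\<^sup>2 * (((p - p0) \<bullet> b)\<^sup>2 / m\<^sup>2))
      * barrier p0 A B \<beta> p l) (at 0)"
proof -
  define x where "x = (p - p0) \<bullet> b"
  define Q where "Q s = sqrt (((norm (p - p0))\<^sup>2 + \<beta>\<^sup>2) + 2 * s * x + s\<^sup>2)" for s
  define E where "E s = barrier p0 A B \<beta> (p + s *\<^sub>R b) l" for s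
  have Q0: "Q 0 = m" unfolding Q_def m by simp
  have "m > 0" using \<open>\<beta> > 0\<close> unfolding m by (simp add: add_nonneg_pos)
  have dQ: "(Q has_real_derivative x / m) (at 0)"
    using has_derivative_sqrt_quadratic[OF shift_Basis_pos[OF b \<open>\<beta> > 0\<close>, of p p0 0]]
    unfolding Q0[symmetric] Q_def x_def by simp
  have dE: "(E has_real_derivative 2 * l * B * (x / m) * E 0) (at 0)"
    using barrier_deriv_centre[OF b \<open>\<beta> > 0\<close>, of p0 A B p l 0]
    unfolding E_def x_def m by simp
  have d1: "((\<lambda>s. x + s) has_real_derivative 1) (at 0)" by (auto intro!: derivative_eq_intros)
  have "((\<lambda>s. 2 * l * B * ((x + s) / Q s) * E s) has_real_derivative
    (2 * l * B * (1 / m - x\<^sup>2 / m ^ 3) + 4 * l\<^sup>2 * B\<^sup>2 * (x\<^sup>2 / m\<^sup>2)) * E 0) (at 0)"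
    by (rule DERIV_cong[OF DERIV_mult[OF DERIV_cmult[OF DERIV_divide[OF d1 dQ]] dE]])
      (use \<open>m > 0\<close> in \<open>simp_all add: Q0 field_simps power2_eq_square power3_eq_cube\<close>)
  then show ?thesis unfolding Q_def x_def E_def by simp
qed

text \<open>The terms of order \<open>l\<^sup>2\<close> are at most
  \<open>4 * l\<^sup>2 * (B\<^sup>2 - (A - 2 * B * m))\<close>, because the gradient of
  \<open>m\<close> has length at most 1. The terms of order \<open>l\<close> are at most
  \<open>2 * DIM('a) * l * (B / \<beta> + 1)\<close>, by \<open>m \<ge> \<beta>\<close>, and the
  assumption on \<open>l\<close> absorbs them.\<close>

lemma barrier_supersolution:
  fixes p p0 :: "'a::euclidean_space" and l :: real
  assumes "\<beta> > 0" "B \<ge> 0" "l > 0" and m: "m = sqrt ((norm (p - p0))\<^sup>2 + \<beta>\<^sup>2)"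
    and l: "2 * DIM('a) * (B / \<beta> + 1) \<le> 4 * l * (A - 2 * B * m - B\<^sup>2)"
  shows "(\<Sum>b\<in>Basis. (2 * l * B * (1 / m - ((p - p0) \<bullet> b)\<^sup>2 / m ^ 3) + 4 * l\<^sup>2 * B\<^sup>2 * (((p - p0) \<bullet> b)\<^sup>2 / m\<^sup>2))
      * barrier p0 A B \<beta> p l)
    + 4 * l\<^sup>2 * (- (A - 2 * B * m) * barrier p0 A B \<beta> p l) + 2 * DIM('a) * l * barrier p0 A B \<beta> p l \<le> 0"
proof -
  define n where "n = real DIM('a)"
  have m\<beta>: "m \<ge> \<beta>" using \<open>\<beta> > 0\<close> unfolding m by (simp add: real_le_rsqrt)
  then have "m > 0" using \<open>\<beta> > 0\<close> by linarith
  have m2: "(norm (p - p0))\<^sup>2 \<le> m\<^sup>2" unfolding m by simp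
  have "(\<Sum>b\<in>Basis. 2 * l * B * (1 / m - ((p - p0) \<bullet> b)\<^sup>2 / m ^ 3) + 4 * l\<^sup>2 * B\<^sup>2 * (((p - p0) \<bullet> b)\<^sup>2 / m\<^sup>2))
      \<le> (\<Sum>b\<in>(Basis::'a set). 2 * l * B * (1 / \<beta>) + 4 * l\<^sup>2 * B\<^sup>2 * (((p - p0) \<bullet> b)\<^sup>2 / m\<^sup>2))"
  proof (intro sum_mono add_right_mono mult_left_mono)
    fix b :: 'a
    have "1 / m \<le> 1 / \<beta>" using m\<beta> \<open>\<beta> > 0\<close> by (simp add: frac_le)
    moreover have "0 \<le> ((p - p0) \<bullet> b)\<^sup>2 / m ^ 3" using \<open>m > 0\<close> by simp
    ultimately show "1 / m - ((p - p0) \<bullet> b)\<^sup>2 / m ^ 3 \<le> 1 / \<beta>" by linarith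
  qed (use assms in auto)
  also have "\<dots> = 2 * l * B * n / \<beta> + 4 * l\<^sup>2 * B\<^sup>2 * ((norm (p - p0))\<^sup>2 / m\<^sup>2)"
    unfolding norm_power2_eq_sum_Basis[of "p - p0"] n_def
    by (simp add: sum.distrib sum_distrib_left sum_divide_distrib)
  also have "\<dots> \<le> 2 * l * B * n / \<beta> + 4 * l\<^sup>2 * B\<^sup>2 * 1"
    using m2 \<open>m > 0\<close> by (intro add_left_mono mult_left_mono) auto
  finally have le: "(\<Sum>b\<in>Basis. 2 * l * B * (1 / m - ((p - p0) \<bullet> b)\<^sup>2 / m ^ 3) + 4 * l\<^sup>2 * B\<^sup>2 * (((p - p0) \<bullet> b)\<^sup>2 / m\<^sup>2))
      + 4 * l\<^sup>2 * (- (A - 2 * B * m)) + 2 * n * l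
    \<le> 2 * l * B * n / \<beta> + 4 * l\<^sup>2 * B\<^sup>2 + 4 * l\<^sup>2 * (- (A - 2 * B * m)) + 2 * n * l" by simp
  also have "\<dots> = l * (2 * n * (B / \<beta> + 1) - 4 * l * (A - 2 * B * m - B\<^sup>2))"
    by (simp add: algebra_simps power2_eq_square)
  also have "\<dots> \<le> 0" using l \<open>l > 0\<close> unfolding n_def by (simp add: mult_le_0_iff)
  finally have "((\<Sum>b\<in>Basis. 2 * l * B * (1 / m - ((p - p0) \<bullet> b)\<^sup>2 / m ^ 3) + 4 * l\<^sup>2 * B\<^sup>2 * (((p - p0) \<bullet> b)\<^sup>2 / m\<^sup>2))
      + 4 * l\<^sup>2 * (- (A - 2 * B * m)) + 2 * n * l) * barrier p0 A B \<beta> p l \<le> 0"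
    by (rule mult_nonpos_nonneg) (simp add: barrier_def)
  then show ?thesis unfolding n_def distrib_right sum_distrib_right by (simp add: mult.assoc)
qed

section \<open>Comparison of the Gaussian transform with the barrier\<close>

lemma gaussian_transform_abs_le:
  fixes f :: "'a::euclidean_space \<Rightarrow> real"
  assumes f: "continuous_on (cbox u v) f" and "l \<ge> 0"
    and sep: "\<And>x. x \<in> cbox u v \<Longrightarrow> f x \<noteq> 0 \<Longrightarrow> d \<le> (norm (x - p))\<^sup>2"
  shows "\<bar>gaussian_transform u v f p l\<bar> \<le> integral (cbox u v) (\<lambda>x. \<bar>f x\<bar>) * exp (- l * d)"
proof -
  have "\<bar>gaussian_transform u v f p l\<bar> \<le> integral (cbox u v) (\<lambda>x. \<bar>f x\<bar> * exp (- l * d))"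
    unfolding gaussian_transform_def real_norm_def[symmetric]
  proof (rule integral_norm_bound_integral)
    fix x assume x: "x \<in> cbox u v"
    show "norm (exp (- l * (norm (x - p))\<^sup>2) * f x) \<le> norm (f x) * exp (- l * d)"
    proof (cases "f x = 0")
      case False
      then have "exp (- l * (norm (x - p))\<^sup>2) \<le> exp (- l * d)"
        using sep[OF x] \<open>l \<ge> 0\<close> by (simp add: mult_left_mono)
      then show ?thesis by (simp add: abs_mult mult.commute mult_left_mono)
    qed simp
  qed (auto intro!: integrable_continuous continuous_intros f)
  then show ?thesis by simp
qed

lemma power_mult_exp_tendsto_0:
  fixes d :: real
  assumes "d > 0"
  shows "((\<lambda>L. L ^ n * exp (- L * d)) \<longlongrightarrow> 0) at_top"
proof -
  have "filterlim (\<lambda>L. L * d) at_top at_top"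
    using assms by (intro filterlim_at_top_mult_tendsto_pos[OF tendsto_const] filterlim_ident) auto
  from filterlim_compose[OF tendsto_power_div_exp_0[of n] this]
  have "((\<lambda>L. (1 / d ^ n) * ((L * d) ^ n / exp (L * d))) \<longlongrightarrow> (1 / d ^ n) * 0) at_top"
    by (intro tendsto_mult tendsto_const)
  then show ?thesis using assms by (simp add: power_mult_distrib exp_minus field_simps)
qed

text \<open>The maximum principle is applied to the transform minus \<open>C\<close> times the
  barrier, a subsolution; the initial slice is pushed to infinite \<open>l\<close>.\<close>

lemma gaussian_transform_le_barrier:
  fixes f :: "'a::euclidean_space \<Rightarrow> real" and l0 l :: real
  assumes f: "continuous_on (cbox u v) f"
    and K: "compact K" "open I" "I \<subseteq> K" and pos: "\<beta> > 0" "B \<ge> 0" "l0 > 0" "d > 0"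
    and super: "\<And>p. p \<in> I \<Longrightarrow>
      2 * DIM('a) * (B / \<beta> + 1) \<le> 4 * l0 * (A - 2 * B * sqrt ((norm (p - p0))\<^sup>2 + \<beta>\<^sup>2) - B\<^sup>2)"
    and sep: "\<And>p x. p \<in> K \<Longrightarrow> x \<in> cbox u v \<Longrightarrow> f x \<noteq> 0 \<Longrightarrow> d \<le> (norm (x - p))\<^sup>2"
    and C: "C = integral (cbox u v) (\<lambda>x. \<bar>f x\<bar>)"
    and bd: "\<And>p (l::real). p \<in> K - I \<Longrightarrow> l0 \<le> l \<Longrightarrow> gaussian_transform u v f p l \<le> C * barrier p0 A B \<beta> p l"
    and pl: "p \<in> K" "l0 \<le> l"
  shows "gaussian_transform u v f p l \<le> C * barrier p0 A B \<beta> p l"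
proof -
  define D where "D p l = gaussian_transform u v f p l - C * barrier p0 A B \<beta> p l" for p and l :: real
  have "C \<ge> 0" unfolding C by (intro integral_nonneg integrable_continuous continuous_intros f) auto
  \<comment> \<open>The left side of \<open>super\<close> is positive, so the bracket on the right
    is too, and the inequality persists as \<open>l0\<close> grows to \<open>l\<close>.\<close>
  have super': "2 * DIM('a) * (B / \<beta> + 1) \<le> 4 * l * (A - 2 * B * sqrt ((norm (p - p0))\<^sup>2 + \<beta>\<^sup>2) - B\<^sup>2)"
    if "p \<in> I" "l0 \<le> l" for p and l :: real
  proof -
    have "0 < 2 * DIM('a) * (B / \<beta> + 1)" using pos by (simp add: add_nonneg_pos)
    then have "0 < 4 * l0 * (A - 2 * B * sqrt ((norm (p - p0))\<^sup>2 + \<beta>\<^sup>2) - B\<^sup>2)"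
      using super[OF that(1)] by linarith
    then have "0 < A - 2 * B * sqrt ((norm (p - p0))\<^sup>2 + \<beta>\<^sup>2) - B\<^sup>2"
      using pos by (simp add: zero_less_mult_iff)
    then have "4 * l0 * (A - 2 * B * sqrt ((norm (p - p0))\<^sup>2 + \<beta>\<^sup>2) - B\<^sup>2)
        \<le> 4 * l * (A - 2 * B * sqrt ((norm (p - p0))\<^sup>2 + \<beta>\<^sup>2) - B\<^sup>2)"
      using that(2) by (intro mult_right_mono) auto
    then show ?thesis using super[OF that(1)] by linarith
  qed
  \<comment> \<open>At \<open>l = L\<close> the two functions are not compared. Instead, the
    distance \<open>sqrt d\<close> from the support makes the weighted transform exponentially
    small, hence at most \<open>\<kappa>\<close> for large \<open>L\<close>; finally
    \<open>\<kappa>\<close> tends to 0.\<close>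
  have le_\<kappa>: "l ^ DIM('a) * D p l \<le> \<kappa>" if "\<kappa> > 0" for \<kappa>
  proof -
    have "((\<lambda>L. C * (L ^ DIM('a) * exp (- L * d))) \<longlongrightarrow> C * 0) at_top"
      by (intro tendsto_intros power_mult_exp_tendsto_0 pos)
    then have "\<forall>\<^sub>F L in at_top. C * (L ^ DIM('a) * exp (- L * d)) < \<kappa>"
      using that by (auto intro: order_tendstoD)
    then obtain L where L: "L \<ge> l" "C * (L ^ DIM('a) * exp (- L * d)) < \<kappa>"
      using eventually_happens'[OF _ eventually_conj[OF _ eventually_ge_at_top[of l]]] by force
    show ?thesis
    proof (rule heat_maximum_principle[where D = D and K = K and I = I and L = L and ?l0.0 = l0])
      show "continuous_on (K \<times> {l0..L}) (\<lambda>(p, l). D p l)"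
        using continuous_on_gaussian_transform[OF f, of "K \<times> {l0..L}"]
        unfolding D_def barrier_def case_prod_beta by (intro continuous_intros) auto
      \<comment> \<open>The right-hand sides here and below fix \<open>Dl\<close>, \<open>D1\<close>
        and \<open>D2\<close>: the derivative of the transform minus \<open>C\<close> times that of
        the barrier.\<close>
      show "(D p has_real_derivative
          integral (cbox u v) (\<lambda>x. - (norm (x - p))\<^sup>2 * exp (- l * (norm (x - p))\<^sup>2) * f x)
          - C * (- (A - 2 * B * sqrt ((norm (p - p0))\<^sup>2 + \<beta>\<^sup>2)) * barrier p0 A B \<beta> p l)) (at l)" for p l
        unfolding D_def
        by (intro DERIV_diff DERIV_cmult gaussian_transform_deriv_scale[OF f] barrier_deriv_scale)
      show "((\<lambda>s. D (p + s *\<^sub>R b) l) has_real_derivative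
          integral (cbox u v) (\<lambda>x. 2 * l * ((x - p) \<bullet> b - s) * exp (- l * (norm (x - (p + s *\<^sub>R b)))\<^sup>2) * f x)
          - C * (2 * l * B * (((p - p0) \<bullet> b + s) / sqrt (((norm (p - p0))\<^sup>2 + \<beta>\<^sup>2) + 2 * s * ((p - p0) \<bullet> b) + s\<^sup>2))
            * barrier p0 A B \<beta> (p + s *\<^sub>R b) l)) (at s)" if "b \<in> Basis" for p l b s
        unfolding D_def using that pos
        by (intro DERIV_diff DERIV_cmult gaussian_transform_deriv_centre[OF f] barrier_deriv_centre)
      show "((\<lambda>s. integral (cbox u v) (\<lambda>x. 2 * l * ((x - p) \<bullet> b - s) * exp (- l * (norm (x - (p + s *\<^sub>R b)))\<^sup>2) * f x)
          - C * (2 * l * B * (((p - p0) \<bullet> b + s) / sqrt (((norm (p - p0))\<^sup>2 + \<beta>\<^sup>2) + 2 * s * ((p - p0) \<bullet> b) + s\<^sup>2))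
            * barrier p0 A B \<beta> (p + s *\<^sub>R b) l)) has_real_derivative
          integral (cbox u v) (\<lambda>x. (4 * l\<^sup>2 * ((x - p) \<bullet> b)\<^sup>2 - 2 * l) * exp (- l * (norm (x - p))\<^sup>2) * f x)
          - C * ((2 * l * B * (1 / sqrt ((norm (p - p0))\<^sup>2 + \<beta>\<^sup>2) - ((p - p0) \<bullet> b)\<^sup>2 / sqrt ((norm (p - p0))\<^sup>2 + \<beta>\<^sup>2) ^ 3)
            + 4 * l\<^sup>2 * B\<^sup>2 * (((p - p0) \<bullet> b)\<^sup>2 / (sqrt ((norm (p - p0))\<^sup>2 + \<beta>\<^sup>2))\<^sup>2)) * barrier p0 A B \<beta> p l)) (at 0)"
        if "b \<in> Basis" for p l b
        using that pos
        by (intro DERIV_diff DERIV_cmult gaussian_transform_deriv2_centre[OF f] barrier_deriv2_centre) auto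
      show "0 \<le> (\<Sum>b\<in>Basis. integral (cbox u v) (\<lambda>x. (4 * l\<^sup>2 * ((x - p) \<bullet> b)\<^sup>2 - 2 * l) * exp (- l * (norm (x - p))\<^sup>2) * f x)
          - C * ((2 * l * B * (1 / sqrt ((norm (p - p0))\<^sup>2 + \<beta>\<^sup>2) - ((p - p0) \<bullet> b)\<^sup>2 / sqrt ((norm (p - p0))\<^sup>2 + \<beta>\<^sup>2) ^ 3)
            + 4 * l\<^sup>2 * B\<^sup>2 * (((p - p0) \<bullet> b)\<^sup>2 / (sqrt ((norm (p - p0))\<^sup>2 + \<beta>\<^sup>2))\<^sup>2)) * barrier p0 A B \<beta> p l))
          + 4 * l\<^sup>2 * (integral (cbox u v) (\<lambda>x. - (norm (x - p))\<^sup>2 * exp (- l * (norm (x - p))\<^sup>2) * f x)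
          - C * (- (A - 2 * B * sqrt ((norm (p - p0))\<^sup>2 + \<beta>\<^sup>2)) * barrier p0 A B \<beta> p l))
          + 2 * DIM('a) * l * D p l" (is "0 \<le> ?lhs") if "p \<in> I" "l0 \<le> l" for p and l :: real
      proof -
        define m where "m = sqrt ((norm (p - p0))\<^sup>2 + \<beta>\<^sup>2)"
        have "l > 0" using that pos by simp
        note sup = barrier_supersolution[OF pos(1,2) this m_def super'[OF that, folded m_def]]
        \<comment> \<open>The Gaussian part cancels by the heat equation; only the barrier is left,
          with the factor \<open>- C\<close>.\<close>
        have "?lhs = - C * ((\<Sum>b\<in>Basis. (2 * l * B * (1 / m - ((p - p0) \<bullet> b)\<^sup>2 / m ^ 3) + 4 * l\<^sup>2 * B\<^sup>2 * (((p - p0) \<bullet> b)\<^sup>2 / m\<^sup>2))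
              * barrier p0 A B \<beta> p l)
            + 4 * l\<^sup>2 * (- (A - 2 * B * m) * barrier p0 A B \<beta> p l) + 2 * DIM('a) * l * barrier p0 A B \<beta> p l)"
          using gaussian_transform_heat_equation[OF f, where p = p and l = l]
          unfolding D_def m_def[symmetric] sum_subtractf sum_distrib_left[symmetric] right_diff_distrib distrib_left
          by (simp add: mult_ac)
        then show ?thesis using sup \<open>C \<ge> 0\<close> by (simp add: mult_le_0_iff zero_le_mult_iff)
      qed
      show "l ^ DIM('a) * D p l \<le> \<kappa>" if "p \<in> K - I" "l0 \<le> l" for p l
      proof -
        have "D p l \<le> 0" using bd[OF that] by (simp add: D_def)
        then have "l ^ DIM('a) * D p l \<le> 0" using that pos by (intro mult_nonneg_nonpos) auto
        then show ?thesis using \<open>\<kappa> > 0\<close> by linarith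
      qed
      show "L ^ DIM('a) * D p L \<le> \<kappa>" if "p \<in> K" for p
      proof -
        have "L \<ge> 0" using L pl pos by linarith
        have "D p L \<le> \<bar>gaussian_transform u v f p L\<bar>"
          using \<open>C \<ge> 0\<close> unfolding D_def barrier_def by (smt (verit) exp_ge_zero mult_nonneg_nonneg)
        also have "\<dots> \<le> C * exp (- L * d)"
          unfolding C using sep[OF that] by (intro gaussian_transform_abs_le f \<open>L \<ge> 0\<close>) auto
        finally have "L ^ DIM('a) * D p L \<le> L ^ DIM('a) * (C * exp (- L * d))"
          using \<open>L \<ge> 0\<close> by (intro mult_left_mono) auto
        then show ?thesis using L(2) by (simp add: mult_ac)
      qed
    qed (use K pos pl L that in auto)
  qed
  have "l ^ DIM('a) * D p l \<le> 0"
  proof (rule field_le_epsilon)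
    show "l ^ DIM('a) * D p l \<le> 0 + \<kappa>" if "0 < \<kappa>" for \<kappa>
      using le_\<kappa>[OF that] by simp
  qed
  moreover have "l ^ DIM('a) > 0" using pl pos by simp
  ultimately have "D p l \<le> 0" by (metis mult_pos_pos not_le)
  then show ?thesis by (simp add: D_def)
qed

text \<open>The Gaussian weight is constant on spheres about \<open>p\<close>, so the weighted
  function \<open>h\<close> has vanishing sphere integrals too, and hence vanishing integral over a
  ball that contains the support.\<close>

lemma gaussian_transform_eq_0_if_sph_mean_eq_0:
  fixes f :: "'a::euclidean_space \<Rightarrow> real"
  assumes f: "continuous_on UNIV f" and supp: "\<And>x. f x \<noteq> 0 \<Longrightarrow> x \<in> cbox u v"
    and zero: "\<And>r. r > 0 \<Longrightarrow> sph_mean f p r = 0"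
  shows "gaussian_transform u v f p l = 0"
proof -
  define h where "h x = exp (- l * (norm (x - p))\<^sup>2) * f x" for x
  have ch: "continuous_on UNIV h" unfolding h_def by (intro continuous_intros f)
  have mf [measurable]: "f \<in> borel_measurable borel" and mh [measurable]: "h \<in> borel_measurable borel"
    using f ch by (auto intro: borel_measurable_continuous_onI)
  have msgn [measurable]: "(sgn :: 'a \<Rightarrow> 'a) \<in> borel_measurable borel"
    unfolding sgn_div_norm by measurable
  have sphere: "(\<integral>w. h (p + r *\<^sub>R w) \<partial>unit_sphere_measure) = 0" if "r > 0" for r
  proof -
    have "(\<integral>w. f (p + r *\<^sub>R w) \<partial>unit_sphere_measure) = 0"
      using zero[OF that] that by (simp add: sph_mean_def)
    then have f0: "(LINT x:ball 0 1|lborel. f (p + r *\<^sub>R sgn x)) = 0"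
      using integral_unit_sphere_measure[of "\<lambda>w. f (p + r *\<^sub>R w)"] by simp
    have "(LINT x:ball 0 1|lborel. h (p + r *\<^sub>R sgn x))
        = (LINT x:ball 0 1|lborel. exp (- l * r\<^sup>2) * f (p + r *\<^sub>R sgn x))"
    \<comment> \<open>Only almost everywhere: \<open>sgn 0 = 0\<close> is not a unit vector.\<close>
    proof (rule set_lebesgue_integral_cong_AE)
      show "AE x\<in>ball 0 1 in lborel. h (p + r *\<^sub>R sgn x) = exp (- l * r\<^sup>2) * f (p + r *\<^sub>R sgn x)"
        using AE_lborel_singleton[of "0::'a"]
      proof eventually_elim
        case (elim x)
        then show ?case using that by (simp add: h_def norm_sgn)
      qed
    qed auto
    also have "\<dots> = exp (- l * r\<^sup>2) * (LINT x:ball 0 1|lborel. f (p + r *\<^sub>R sgn x))"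
      by (rule set_integral_mult_right)
    finally show ?thesis
      using integral_unit_sphere_measure[of "\<lambda>w. h (p + r *\<^sub>R w)"] f0 by simp
  qed
  obtain R where R: "\<And>x. x \<in> cbox u v \<Longrightarrow> norm x \<le> R"
    using bounded_cbox[of u v] unfolding bounded_iff by blast
  \<comment> \<open>Large enough for the ball of radius \<open>m\<close> about \<open>p\<close> to
    contain the box.\<close>
  define m where "m = nat \<lceil>R + norm p + 1\<rceil>"
  have h0: "h (p + x) = 0" if "x \<notin> ball 0 (real m)" for x
  proof (rule ccontr)
    assume "h (p + x) \<noteq> 0"
    then have "norm (p + x) \<le> R" using supp R by (auto simp: h_def)
    moreover have "norm x \<le> norm (p + x) + norm p" by norm
    moreover have "R + norm p + 1 \<le> real m" unfolding m_def by linarith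
    ultimately show False using that by simp
  qed
  have "(\<integral>x. h x \<partial>lborel) = (\<integral>x. h x \<partial>distr lborel borel (\<lambda>x. p + x))"
    by (simp add: lborel_distr_plus)
  also have "\<dots> = (\<integral>x. h (p + x) \<partial>lborel)" by (rule integral_distr) auto
  also have "\<dots> = (LINT x:ball 0 (real m)|lborel. h (p + x))"
    unfolding set_lebesgue_integral_def using h0 by (intro Bochner_Integration.integral_cong) (auto simp: indicator_def)
  also have "\<dots> = 0"
    by (rule integral_ball_eq_0_if_sphere_integrals_eq_0)
      (auto intro!: sphere continuous_on_compose2[OF ch] continuous_intros)
  finally have "(\<integral>x. h x \<partial>lborel) = 0" .
  moreover have "(\<integral>x. h x \<partial>lborel) = (LINT x:cbox u v|lborel. h x)"
    unfolding set_lebesgue_integral_def using supp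
    by (intro Bochner_Integration.integral_cong) (auto simp: indicator_def h_def)
  moreover have "set_integrable lborel (cbox u v) h"
    unfolding set_integrable_def
    by (intro borel_integrable_compact continuous_on_subset[OF ch]) auto
  ultimately have "integral (cbox u v) h = 0" using set_borel_integral_eq_integral(2) by fastforce
  then show ?thesis unfolding gaussian_transform_def h_def .
qed

subsection \<open>The theorem\<close>

text \<open>A front from \<open>y\<close> moving across the tangent plane traces along it faster than the front
  itself moves; quantitatively, leaving \<open>0\<close> along (or behind) the plane brings one closer to \<open>y\<close>
  only at the rate \<open>sqrt (r\<^sup>2 - c\<^sup>2) / r < 1\<close>.\<close>

lemma dist_power2_ge_behind_plane:
  fixes N q y :: "'a::real_inner"
  assumes N: "norm N = 1" and c: "0 < c" "c \<le> N \<bullet> y" and r: "c \<le> r" "r \<le> norm y" and R: "norm y \<le> R"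
    and q: "N \<bullet> q \<le> \<eta> * norm q" and "\<eta> \<ge> 0"
  shows "r\<^sup>2 - 2 * norm q * (sqrt (r\<^sup>2 - c\<^sup>2) + \<eta> * R) \<le> (norm (y - q))\<^sup>2"
proof -
  define e where "e = norm q"
  \<comment> \<open>\<open>d\<close> and \<open>t\<close> are the lengths of the normal and
    tangential parts of \<open>y\<close>; \<open>t0\<close> is the largest tangential part
    compatible with length \<open>r\<close> and normal part at least \<open>c\<close>.\<close>
  define d where "d = N \<bullet> y"
  define t where "t = sqrt ((norm y)\<^sup>2 - d\<^sup>2)"
  define t0 where "t0 = sqrt (r\<^sup>2 - c\<^sup>2)"
  have NN: "N \<bullet> N = 1" using N by (simp add: norm_eq_1)
  have "e \<ge> 0" "t0 \<ge> 0" using c r unfolding e_def t0_def by (auto intro!: power_mono)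
  have dy: "d \<le> norm y" using norm_cauchy_schwarz[of N y] N by (simp add: d_def)
  have "d > 0" using c unfolding d_def by linarith
  have t2: "t\<^sup>2 = (norm y)\<^sup>2 - d\<^sup>2"
    unfolding t_def using dy \<open>d > 0\<close> by (simp add: power_mono)
  have t02: "t0\<^sup>2 = r\<^sup>2 - c\<^sup>2"
    unfolding t0_def using r c by (simp add: power_mono)
  have norm_y': "norm (y - d *\<^sub>R N) = t"
  proof -
    have "(norm (y - d *\<^sub>R N))\<^sup>2 = (norm y)\<^sup>2 - d\<^sup>2"
      unfolding power2_norm_eq_inner
      by (simp add: inner_diff_left inner_diff_right NN inner_commute[of y N] d_def[symmetric] power2_eq_square)
    then show ?thesis unfolding t_def by (metis norm_ge_zero real_sqrt_unique)
  qed
  have "q \<bullet> (y - d *\<^sub>R N) \<le> e * t"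
    using norm_cauchy_schwarz[of q "y - d *\<^sub>R N"] norm_y' by (simp add: e_def)
  \<comment> \<open>\<open>q\<close> may protrude in front of the plane by
    \<open>\<eta> * norm q\<close>; this is the price, since \<open>d \<le> R\<close>.\<close>
  moreover have "d * (N \<bullet> q) \<le> e * (\<eta> * R)"
  proof -
    have "d * (N \<bullet> q) \<le> d * (\<eta> * e)" using q \<open>d > 0\<close> unfolding e_def by (intro mult_left_mono) auto
    also have "\<dots> \<le> R * (\<eta> * e)"
      using dy R \<open>\<eta> \<ge> 0\<close> \<open>e \<ge> 0\<close> by (intro mult_right_mono) auto
    finally show ?thesis by (simp add: mult_ac)
  qed
  ultimately have qy: "q \<bullet> y \<le> e * t + e * (\<eta> * R)"
    by (simp add: inner_diff_right inner_commute[of q N])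
  have "(norm (y - q))\<^sup>2 = (norm y)\<^sup>2 - 2 * (q \<bullet> y) + e\<^sup>2"
    unfolding power2_norm_eq_inner e_def by (simp add: inner_diff_left inner_diff_right inner_commute[of y q])
  \<comment> \<open>Two lower bounds for \<open>(norm y)\<^sup>2\<close> are available:
    \<open>c\<^sup>2 + t\<^sup>2\<close>, used for large \<open>t\<close>, and
    \<open>r\<^sup>2\<close>, used for small \<open>t\<close>. They agree at
    \<open>t = t0\<close>.\<close>
  moreover have "r\<^sup>2 - 2 * e * t0 \<le> (norm y)\<^sup>2 - 2 * e * t + e\<^sup>2"
  proof (cases "t \<ge> t0")
    case True
    have "c\<^sup>2 \<le> d\<^sup>2" using c unfolding d_def by (intro power_mono) auto
    moreover have "0 \<le> (t - t0 - e)\<^sup>2 + 2 * (t - t0) * t0" using True \<open>t0 \<ge> 0\<close> by simp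
    then have "t0\<^sup>2 - 2 * e * t0 \<le> t\<^sup>2 - 2 * e * t + e\<^sup>2"
      by (simp add: power2_eq_square algebra_simps)
    ultimately show ?thesis using t2 t02 by linarith
  next
    case False
    have "r\<^sup>2 \<le> (norm y)\<^sup>2" using r c by (intro power_mono) auto
    moreover have "2 * e * t \<le> 2 * e * t0" using False \<open>e \<ge> 0\<close> by (intro mult_left_mono) auto
    ultimately show ?thesis using zero_le_power2[of e] by linarith
  qed
  ultimately have "r\<^sup>2 - 2 * e * t0 - 2 * (e * (\<eta> * R)) \<le> (norm (y - q))\<^sup>2" using qy by linarith
  then show ?thesis unfolding e_def[symmetric] t0_def[symmetric] by (simp add: algebra_simps)
qed

theorem theorem18:
  fixes f :: "'a::euclidean_space \<Rightarrow> real"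
    and M S :: "'a set" and p0 :: 'a
  assumes "C1_hypersurface M"
    and "S \<subseteq> M" and "openin (top_of_set M) S"
    and "continuous_on UNIV f" and "compact (closure {x. f x \<noteq> 0})"
    and "\<forall>p\<in>S. \<forall>r>0. sph_mean f p r = 0"
    and "p0 \<in> S"
    and "local_defining_fn M p0 U g G"
    and "closure {x. f x \<noteq> 0} \<subseteq> {x. G p0 \<bullet> (x - p0) > 0}"
  shows "\<forall>x. f x = 0"
proof (rule ccontr)
  assume "\<not> (\<forall>x. f x = 0)"
  define T where "T = closure {x. f x \<noteq> 0}"
  have T: "compact T" "T \<noteq> {}" using assms(5) \<open>\<not> (\<forall>x. f x = 0)\<close> by (auto simp: T_def)
  have fT: "x \<in> T" if "f x \<noteq> 0" for x
    using that closure_subset[of "{x. f x \<noteq> 0}"] by (auto simp: T_def)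
  have U: "open U" "p0 \<in> U" "G p0 \<noteq> 0" "M \<inter> U = {x\<in>U. g x = 0}"
    and dg: "\<And>x. x \<in> U \<Longrightarrow> (g has_derivative (\<lambda>v. G x \<bullet> v)) (at x)"
    using assms(8) by (auto simp: local_defining_fn_def)
  have cg: "continuous_on U g"
    by (auto intro!: continuous_at_imp_continuous_on has_derivative_continuous[OF dg])
  have gp0: "g p0 = 0" using U assms(2,7) by blast
  obtain W where W: "open W" "S = M \<inter> W" using assms(3) by (auto simp: openin_open)

  define N where "N = G p0 /\<^sub>R norm (G p0)"
  have N: "norm N = 1" using U by (simp add: N_def)
  have GN: "G p0 = norm (G p0) *\<^sub>R N" using U by (simp add: N_def)
  have NT: "N \<bullet> (x - p0) > 0" if "x \<in> T" for x
    using assms(9) that U unfolding T_def N_def by auto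
  \<comment> \<open>Compactness turns strict one-sidedness into a margin \<open>c > 0\<close>
    between support and tangent plane.\<close>
  have "continuous_on T (\<lambda>x. N \<bullet> (x - p0))" by (intro continuous_intros)
  then obtain xc where xc: "xc \<in> T" "\<And>x. x \<in> T \<Longrightarrow> N \<bullet> (xc - p0) \<le> N \<bullet> (x - p0)"
    using continuous_attains_inf[OF T] by blast
  define c where "c = N \<bullet> (xc - p0)"
  have "c > 0" using NT[OF xc(1)] by (simp add: c_def)
  obtain y0 where y0: "y0 \<in> T" "\<And>x. x \<in> T \<Longrightarrow> dist p0 y0 \<le> dist p0 x"
    using distance_attains_inf[OF compact_imp_closed[OF T(1)] T(2), of p0] by blast
  define r where "r = norm (y0 - p0)"
  have rT: "r \<le> norm (x - p0)" if "x \<in> T" for x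
    using y0(2)[OF that] by (simp add: r_def dist_norm norm_minus_commute)
  have "c \<le> r"
    using xc(2)[OF y0(1)] norm_cauchy_schwarz[of N "y0 - p0"] N by (simp add: c_def r_def)
  have "r > 0" using \<open>c \<le> r\<close> \<open>c > 0\<close> by linarith
  obtain R where "\<And>x. x \<in> T \<Longrightarrow> dist p0 x \<le> R"
    using compact_imp_bounded[OF T(1)] bounded_any_center[of T p0] by blast
  then have RT: "norm (x - p0) \<le> R" if "x \<in> T" for x
    using that by (metis dist_commute dist_norm)
  have "r \<le> R" using RT[OF y0(1)] by (simp add: r_def)
  \<comment> \<open>The constant of \<open>dist_power2_ge_behind_plane\<close>;
    \<open>t0 < r\<close> is where the margin \<open>c > 0\<close> enters.\<close>
  define t0 where "t0 = sqrt (r\<^sup>2 - c\<^sup>2)"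
  have "t0 \<ge> 0" using \<open>c \<le> r\<close> \<open>c > 0\<close> by (simp add: t0_def power_mono)
  have "t0 < r"
  proof -
    have "t0 < sqrt (r\<^sup>2)" unfolding t0_def using \<open>c > 0\<close> by (intro real_sqrt_less_mono) simp
    then show ?thesis using \<open>r > 0\<close> by simp
  qed
  \<comment> \<open>\<open>\<eta>\<close> is the relative deviation from the tangent plane to be
    tolerated. It costs a quarter of the gap \<open>r - t0\<close>, so \<open>2 * b\<close>, which
    bounds the rate of decrease of the squared distance to the support, stays below
    \<open>2 * r\<close>, and \<open>B\<close> fits strictly between \<open>b\<close> and
    \<open>r\<close>.\<close>
  define \<eta> where "\<eta> = (r - t0) / (4 * R)"
  have R: "R > 0" using \<open>r \<le> R\<close> \<open>r > 0\<close> by linarith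
  have \<eta>: "\<eta> > 0" "\<eta> < 1" "\<eta> * R = (r - t0) / 4"
    using R \<open>t0 < r\<close> \<open>t0 \<ge> 0\<close> \<open>r \<le> R\<close> by (auto simp: \<eta>_def field_simps)
  define b where "b = t0 + \<eta> * R"
  define B where "B = (b + r) / 2"
  have b: "b > 0" "b < B" "B < r" "B > 0"
    using \<open>t0 < r\<close> \<open>t0 \<ge> 0\<close> unfolding B_def b_def \<eta>(3) by (auto simp: field_simps)
  have "B\<^sup>2 < r\<^sup>2" using b by (intro power_strict_mono) auto

  obtain e1 where e1: "e1 > 0" "cball p0 e1 \<subseteq> U \<inter> W"
    using open_contains_cball[of "U \<inter> W"] U W assms(7) by blast
  obtain e2 where e2: "e2 > 0" "\<And>q. norm (q - p0) < e2 \<Longrightarrow>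
      norm (g q - g p0 - G p0 \<bullet> (q - p0)) \<le> (\<eta> * norm (G p0)) * norm (q - p0)"
    using dg[OF U(2)] U(3) \<eta>(1) unfolding has_derivative_at_alt by (meson mult_pos_pos zero_less_norm_iff)
  have linear: "\<bar>g q - norm (G p0) * (N \<bullet> (q - p0))\<bar> \<le> norm (G p0) * (\<eta> * norm (q - p0))"
    if "norm (q - p0) < e2" for q
  proof -
    have "G p0 \<bullet> (q - p0) = norm (G p0) * (N \<bullet> (q - p0))" by (subst GN) simp
    then show ?thesis using e2(2)[OF that] gp0 by (simp add: mult_ac)
  qed

  \<comment> \<open>In this order: the ball stays in \<open>U \<inter> W\<close>, the linearization
    of \<open>g\<close> is valid on it, it keeps distance \<open>r / 2\<close> from the support, and
    the decay rate of the barrier stays above \<open>B\<^sup>2\<close> on it.\<close>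
  define \<epsilon> where "\<epsilon> = Min {e1, e2 / 2, r / 2, (r\<^sup>2 - B\<^sup>2) / (4 * b)}"
  have \<epsilon>: "\<epsilon> > 0" "\<epsilon> \<le> e1" "\<epsilon> < e2" "\<epsilon> \<le> r / 2" "\<epsilon> \<le> (r\<^sup>2 - B\<^sup>2) / (4 * b)"
  proof -
    show "\<epsilon> > 0" unfolding \<epsilon>_def using e1 e2 \<open>r > 0\<close> b \<open>B\<^sup>2 < r\<^sup>2\<close> by simp
    have "\<epsilon> \<le> e2 / 2" unfolding \<epsilon>_def by (rule Min_le) auto
    then show "\<epsilon> < e2" using e2 by simp
  qed (auto simp: \<epsilon>_def)
  have cball_UW: "cball p0 \<epsilon> \<subseteq> U \<inter> W" using e1 \<epsilon> by (meson order_trans subset_cball)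
  \<comment> \<open>\<open>G p0\<close> points towards the support, so \<open>g \<le> 0\<close> is
    the side behind \<open>S\<close>. \<open>K - I\<close> consists of points of \<open>S\<close>
    and of points of the sphere of radius \<open>\<epsilon>\<close> with
    \<open>g < 0\<close>.\<close>
  define K where "K = {p \<in> cball p0 \<epsilon>. g p \<le> 0}"
  define I where "I = {p \<in> ball p0 \<epsilon>. g p < 0}"
  have cg': "continuous_on (cball p0 \<epsilon>) g" using cg cball_UW continuous_on_subset by blast
  have "compact K"
  proof -
    have "closed (cball p0 \<epsilon> \<inter> g -` {..0})"
      by (intro continuous_closed_preimage cg') auto
    moreover have "K = cball p0 \<epsilon> \<inter> g -` {..0}" by (auto simp: K_def)
    ultimately show ?thesis
      by (metis bounded_cball bounded_subset compact_eq_bounded_closed inf_le1)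
  qed
  have "open I"
  proof -
    have "open (ball p0 \<epsilon> \<inter> g -` {..<0})"
      by (intro continuous_open_preimage continuous_on_subset[OF cg']) auto
    moreover have "I = ball p0 \<epsilon> \<inter> g -` {..<0}" by (auto simp: I_def)
    ultimately show ?thesis by simp
  qed
  have "I \<subseteq> K" by (auto simp: I_def K_def)

  \<comment> \<open>Rounding off the cone costs
    \<open>2 * B * \<beta> = \<epsilon> * (B - b)\<close>, half of the gain
    \<open>2 * \<epsilon> * (B - b)\<close> over \<open>r\<^sup>2\<close> at its vertex.\<close>
  define \<beta> where "\<beta> = \<epsilon> * (B - b) / (2 * B)"
  have "\<beta> > 0" using \<epsilon> b by (simp add: \<beta>_def)
  \<comment> \<open>Normalized so that on the sphere of radius \<open>\<epsilon>\<close> the rate is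
    \<open>r\<^sup>2 - 2 * \<epsilon> * b\<close>, the lower bound for the squared distance to the
    support there.\<close>
  define A where "A = r\<^sup>2 - 2 * \<epsilon> * b + 2 * B * sqrt (\<epsilon>\<^sup>2 + \<beta>\<^sup>2)"
  define \<Theta> where "\<Theta> p = A - 2 * B * sqrt ((norm (p - p0))\<^sup>2 + \<beta>\<^sup>2)" for p
  have barrier_\<Theta>: "barrier p0 A B \<beta> p l = exp (- l * \<Theta> p)" for p l
    by (simp add: barrier_def \<Theta>_def)
  have \<Theta>_ge: "r\<^sup>2 - 2 * \<epsilon> * b \<le> \<Theta> p" if "p \<in> cball p0 \<epsilon>" for p
  proof -
    have "norm (p - p0) \<le> \<epsilon>" using that by (simp add: dist_norm norm_minus_commute)
    then have "sqrt ((norm (p - p0))\<^sup>2 + \<beta>\<^sup>2) \<le> sqrt (\<epsilon>\<^sup>2 + \<beta>\<^sup>2)"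
      by (intro real_sqrt_le_mono add_right_mono power_mono) auto
    then have "2 * B * sqrt ((norm (p - p0))\<^sup>2 + \<beta>\<^sup>2) \<le> 2 * B * sqrt (\<epsilon>\<^sup>2 + \<beta>\<^sup>2)"
      using b by (intro mult_left_mono) auto
    then show ?thesis by (simp add: \<Theta>_def A_def)
  qed
  \<comment> \<open>Halfway between \<open>r\<^sup>2\<close> and the lower bound
    \<open>r\<^sup>2 + \<epsilon> * (B - b)\<close> for \<open>\<Theta> p0\<close>.\<close>
  define a where "a = r\<^sup>2 + \<epsilon> * (B - b) / 2"
  have "r\<^sup>2 < a" using \<epsilon> b by (simp add: a_def)
  have "a < \<Theta> p0"
  proof -
    have "\<epsilon> \<le> sqrt (\<epsilon>\<^sup>2 + \<beta>\<^sup>2)" using \<epsilon> by (simp add: real_le_rsqrt)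
    then have "2 * B * \<epsilon> \<le> 2 * B * sqrt (\<epsilon>\<^sup>2 + \<beta>\<^sup>2)" using b by (intro mult_left_mono) auto
    moreover have "2 * B * \<beta> = \<epsilon> * (B - b)" using b by (simp add: \<beta>_def)
    ultimately have "r\<^sup>2 - 2 * \<epsilon> * b + 2 * B * \<epsilon> - \<epsilon> * (B - b) \<le> \<Theta> p0"
      using \<open>\<beta> > 0\<close> by (simp add: \<Theta>_def A_def)
    moreover have "r\<^sup>2 - 2 * \<epsilon> * b + 2 * B * \<epsilon> - \<epsilon> * (B - b) = r\<^sup>2 + \<epsilon> * (B - b)"
      by (simp add: algebra_simps)
    moreover have "0 < \<epsilon> * (B - b)" using \<epsilon> b by simp
    ultimately show ?thesis unfolding a_def by linarith
  qed
  \<comment> \<open>Solves the condition \<open>super\<close> for the bound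
    \<open>\<Theta> p - B\<^sup>2 \<ge> (r\<^sup>2 - B\<^sup>2) / 2\<close>, valid on
    \<open>I\<close>.\<close>
  define l0 where "l0 = DIM('a) * (B / \<beta> + 1) / (r\<^sup>2 - B\<^sup>2)"
  have "B / \<beta> > 0" using b \<open>\<beta> > 0\<close> by simp
  have "l0 > 0" using \<open>B / \<beta> > 0\<close> \<open>B\<^sup>2 < r\<^sup>2\<close> by (simp add: l0_def)

  obtain w where w: "T \<subseteq> box (- w) w"
    using bounded_subset_box_symmetric[OF compact_imp_bounded[OF T(1)]] by blast
  have box_ne: "box (- w) w \<noteq> {}" using w T by auto
  have supp: "x \<in> cbox (- w) w" if "f x \<noteq> 0" for x
    using fT[OF that] w box_subset_cbox by blast
  define V where "V = gaussian_transform (- w) w f"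
  define C where "C = integral (cbox (- w) w) (\<lambda>x. \<bar>f x\<bar>)"
  have cf: "continuous_on (cbox (- w) w) f" using assms(4) continuous_on_subset by blast
  have V_neg: "gaussian_transform (- w) w (\<lambda>x. - f x) p l = - V p l" for p l
    by (simp add: V_def gaussian_transform_def)
  have sep: "(r / 2)\<^sup>2 \<le> (norm (x - p))\<^sup>2" if "p \<in> K" "f x \<noteq> 0" for p x
  proof (rule power_mono)
    have "norm (p - p0) \<le> r / 2"
      using that(1) \<epsilon> by (simp add: K_def dist_norm norm_minus_commute)
    moreover have "norm (x - p0) \<le> norm (x - p) + norm (p - p0)" by norm
    ultimately show "r / 2 \<le> norm (x - p)" using rT[OF fT[OF that(2)]] by linarith
  qed (use \<open>r > 0\<close> in simp)
  have bd: "\<bar>V p l\<bar> \<le> C * barrier p0 A B \<beta> p l" if p: "p \<in> K - I" and l: "l0 \<le> l" for p l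
  proof (cases "g p = 0")
    case True
    have "p \<in> U \<inter> W" using p cball_UW by (auto simp: K_def)
    then have "p \<in> S" using True U W by blast
    then have "V p l = 0"
      unfolding V_def using assms(6) by (intro gaussian_transform_eq_0_if_sph_mean_eq_0 assms(4) supp) auto
    moreover have "C \<ge> 0"
      unfolding C_def by (intro integral_nonneg integrable_continuous continuous_intros cf) auto
    ultimately show ?thesis by (simp add: barrier_def)
  next
    case False
    then have gp: "g p < 0" and np: "norm (p - p0) = \<epsilon>"
      using p by (auto simp: K_def I_def dist_norm norm_minus_commute)
    \<comment> \<open>Behind \<open>S\<close> need not mean behind the tangent plane, but the
      linearization limits the excess to \<open>\<eta> * norm (p - p0)\<close>.\<close>
    have "norm (G p0) * (N \<bullet> (p - p0)) \<le> norm (G p0) * (\<eta> * norm (p - p0))"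
      using linear[of p] np \<epsilon> gp by linarith
    then have Np: "N \<bullet> (p - p0) \<le> \<eta> * norm (p - p0)"
      using U by (simp add: mult_le_cancel_left)
    have "\<bar>V p l\<bar> \<le> C * exp (- l * (r\<^sup>2 - 2 * \<epsilon> * b))"
      unfolding V_def C_def
    proof (rule gaussian_transform_abs_le[OF cf])
      show "l \<ge> 0" using l \<open>l0 > 0\<close> by linarith
      fix x assume "f x \<noteq> 0"
      then have "x \<in> T" by (rule fT)
      then show "r\<^sup>2 - 2 * \<epsilon> * b \<le> (norm (x - p))\<^sup>2"
        using dist_power2_ge_behind_plane[OF N \<open>c > 0\<close> _ \<open>c \<le> r\<close> _ _ Np, of "x - p0" R]
          xc(2) rT RT \<eta>(1) np by (simp add: c_def t0_def b_def)
    qed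
    moreover have "\<Theta> p = r\<^sup>2 - 2 * \<epsilon> * b" by (simp add: \<Theta>_def A_def np)
    ultimately show ?thesis by (simp add: barrier_\<Theta>)
  qed
  have super: "2 * DIM('a) * (B / \<beta> + 1) \<le> 4 * l0 * (A - 2 * B * sqrt ((norm (p - p0))\<^sup>2 + \<beta>\<^sup>2) - B\<^sup>2)"
    if "p \<in> I" for p
  proof -
    have "4 * b * \<epsilon> \<le> r\<^sup>2 - B\<^sup>2" using \<epsilon>(5) b by (simp add: field_simps)
    moreover have "r\<^sup>2 - (4 * b * \<epsilon>) / 2 \<le> \<Theta> p"
      using \<Theta>_ge[of p] that by (simp add: I_def mult_ac)
    ultimately have "(r\<^sup>2 - B\<^sup>2) / 2 \<le> \<Theta> p - B\<^sup>2" by argo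
    then have "4 * l0 * ((r\<^sup>2 - B\<^sup>2) / 2) \<le> 4 * l0 * (\<Theta> p - B\<^sup>2)"
      using \<open>l0 > 0\<close> by (intro mult_left_mono) auto
    moreover have "4 * l0 * ((r\<^sup>2 - B\<^sup>2) / 2) = 2 * DIM('a) * (B / \<beta> + 1)"
      using \<open>B\<^sup>2 < r\<^sup>2\<close> by (simp add: l0_def)
    ultimately show ?thesis by (simp add: \<Theta>_def)
  qed
  have V_le: "\<bar>V p l\<bar> \<le> C * barrier p0 A B \<beta> p l" if "p \<in> K" "l0 \<le> l" for p l
  proof -
    note common = \<open>compact K\<close> \<open>open I\<close> \<open>I \<subseteq> K\<close> \<open>\<beta> > 0\<close> less_imp_le[OF b(4)] \<open>l0 > 0\<close>
    have "V p l \<le> C * barrier p0 A B \<beta> p l"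
      unfolding V_def
      by (rule gaussian_transform_le_barrier[OF cf common, where d = "(r / 2)\<^sup>2"])
        (use \<open>r > 0\<close> super sep that bd in \<open>auto simp: C_def V_def abs_le_iff\<close>)
    \<comment> \<open>The comparison is one-sided; \<open>- f\<close> supplies the lower
      bound.\<close>
    moreover have "gaussian_transform (- w) w (\<lambda>x. - f x) p l \<le> C * barrier p0 A B \<beta> p l"
      by (rule gaussian_transform_le_barrier[OF continuous_on_minus[OF cf] common, where d = "(r / 2)\<^sup>2"])
        (use \<open>r > 0\<close> super sep that bd in \<open>auto simp: C_def V_neg abs_le_iff\<close>)
    ultimately show ?thesis by (simp add: V_neg abs_le_iff)
  qed

  have c\<Theta>: "continuous_on UNIV \<Theta>" unfolding \<Theta>_def by (intro continuous_intros)
  \<comment> \<open>Centres at which the decay rate exceeds \<open>a\<close> while \<open>y0\<close>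
    is closer than \<open>sqrt a\<close>.\<close>
  define Q where "Q = \<Theta> -` {a<..} \<inter> {p. (norm (y0 - p))\<^sup>2 < a}"
  have "open Q" unfolding Q_def
    by (intro open_Int open_vimage c\<Theta> open_Collect_less continuous_intros)
  moreover have "p0 \<in> Q" using \<open>a < \<Theta> p0\<close> \<open>r\<^sup>2 < a\<close> by (simp add: Q_def r_def)
  ultimately obtain \<delta> where \<delta>: "\<delta> > 0" "ball p0 \<delta> \<subseteq> Q" using openE by blast
  define t where "t = min \<delta> \<epsilon> / 2"
  have t: "0 < t" "t < \<delta>" "t < \<epsilon>" using \<delta>(1) \<epsilon>(1) by (auto simp: t_def min_def)
  \<comment> \<open>Decay must hold on a whole ball of centres, but \<open>p0\<close> lies on the
    boundary of \<open>K\<close>; so the centre is moved along the normal into \<open>I\<close>,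
    where \<open>\<eta> < 1\<close> ensures \<open>g p < 0\<close>.\<close>
  define p where "p = p0 - t *\<^sub>R N"
  have np: "norm (p - p0) = t" using t N by (simp add: p_def)
  have "g p < 0"
  proof -
    have "N \<bullet> (p - p0) = - t" using N by (simp add: p_def norm_eq_1)
    then have "g p \<le> norm (G p0) * (\<eta> * t) - norm (G p0) * t"
      using linear[of p] np t \<epsilon> by (simp add: abs_le_iff)
    also have "\<dots> = - (norm (G p0) * t * (1 - \<eta>))" by (simp add: algebra_simps)
    also have "\<dots> < 0" using U t \<eta> by simp
    finally show ?thesis .
  qed
  then have "p \<in> I \<inter> Q" using np t \<delta> by (auto simp: I_def dist_norm norm_minus_commute)
  then obtain e where e: "e > 0" "ball p e \<subseteq> I \<inter> Q"
    using openE[OF open_Int[OF \<open>open I\<close> \<open>open Q\<close>]] by metis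
  have decay: "\<bar>V q l\<bar> \<le> C * exp (- l * a)" if "q \<in> ball p e" "l0 \<le> l" for q l
  proof -
    have q: "q \<in> K" "a < \<Theta> q" using that e \<open>I \<subseteq> K\<close> by (auto simp: Q_def)
    have "\<bar>V q l\<bar> \<le> C * exp (- l * \<Theta> q)" using V_le[OF q(1) that(2)] by (simp add: barrier_\<Theta>)
    also have "\<dots> \<le> C * exp (- l * a)"
      using q(2) that \<open>l0 > 0\<close> unfolding C_def
      by (intro mult_left_mono integral_nonneg integrable_continuous continuous_intros cf) auto
    finally show ?thesis .
  qed
  have f0: "f x = 0" if "(norm (x - p))\<^sup>2 < a" for x
  proof (cases "x \<in> cbox (- w) w")
    case True
    show ?thesis
      by (rule gaussian_transform_decay_imp_eq_0[OF cf box_ne e(1) _ True that])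
        (use decay in \<open>auto simp: V_def gaussian_transform_def\<close>)
  qed (use supp in blast)
  \<comment> \<open>\<open>f\<close> vanishes on a neighbourhood of \<open>y0\<close>, although
    \<open>y0\<close> lies in the closure of the set where \<open>f\<close> is nonzero.\<close>
  have "open {x. (norm (x - p))\<^sup>2 < a}" by (intro open_Collect_less continuous_intros)
  moreover have "y0 \<in> {x. (norm (x - p))\<^sup>2 < a}"
    using \<open>p \<in> I \<inter> Q\<close> by (simp add: Q_def)
  ultimately have "{x. (norm (x - p))\<^sup>2 < a} \<inter> {x. f x \<noteq> 0} \<noteq> {}"
    using y0(1) open_Int_closure_eq_empty unfolding T_def by blast
  then show False using f0 by auto
qed

end
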